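(* For any $x\in H$, the $\mathbb R^\infty$-valued process $X=(X_t^x)_{t\ge0}$ with components $$X_t^n=e^{-\gamma_nt}x_n+\int_0^te^{-\gamma_n(t-s)}\beta_n\,dZ_s^n,\qquad n\in\mathbb N,\ t\ge0,$$ takes values in $H$ if and only if $$\sum_{n\ge1}\frac{\beta_n^\alpha}{\gamma_n}<\infty .$$ Under this condition it can be written as $$X_t^x=\sum_{n\ge1}X_t^ne_n=e^{tA}x+Z_A(t),\qquad Z_A(t)=\int_0^te^{(t-s)A}dZ_s=\sum_{n\ge1}\Big(\int_0^te^{-\gamma_n(t-s)}\beta_n\,dZ_s^n\Big)e_n ,$$ the process $(X_t^x)$ is $\mathcal F_t$-adapted for every $x\in H$, and $X$ is Markovian.
   Context: Let $H$ be a real separable (infinite-dimensional) Hilbert space with a fixed orthonormal basis $(e_n)_{n\ge1}$; $x\in H$ is identified with $(x_n)=(\langle x,e_n\rangle)\in\ell^2\subset\mathbb R^\infty=\mathbb R^{\mathbb N}$. Fix $\alpha\in(0,2)$. $(Z^n_t)_{t\ge0}$, $n\ge1$, are independent real normalized symmetric $\alpha$-stable Lévy processes, $\mathbb E[e^{ihZ^n_t}]=e^{-t|h|^\alpha}$, on a stochastic basis $(\Omega,\mathcal F,(\mathcal F_t)_{t\ge0},\mathbb P)$ satisfying the usual assumptions (adapted, with the increments of $(Z^n)_{n\ge 1}$ after time $s$ independent of $\mathcal F_s$). $(\beta_n)$ is a sequence of positive reals and $Z_t=\sum_n\beta_nZ^n_te_n$ (a cylindrical $\alpha$-stable process, formal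 series). $A:D(A)\subset H\to H$ is self-adjoint with $e_n\in D(A)$, $Ae_n=-\gamma_ne_n$, $\gamma_n>0$ for all $n\ge 1$, and $\gamma_n\to+\infty$; $e^{tA}e_k=e^{-\gamma_kt}e_k$. "Takes values in $H$" means that for every $t\ge0$, $X_t^x\in H$ (i.e. $\sum_n|X^n_t|^2<\infty$) $\mathbb P$-a.s. "Markovian" means that $\mathbb E[f(X^x_{t+h})\mid\mathcal F_t]=(R_hf)(X_t^x)$ $\mathbb P$-a.s. for all $t,h\ge0$ and bounded Borel $f:H\to\mathbb R$, where $R_hf(y)=\mathbb E[f(X_h^y)]$. *)

theory Defs
  imports "HOL-Probability.Probability"
begin

text \<open>Indices \<open>n \<ge> 1\<close> are shifted to \<open>n \<ge> 0\<close> throughout; time is \<open>real\<close>, and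
  only its values in \<open>[0, \<infinity>)\<close> matter.\<close>

definition orthonormal_basis :: "(nat \<Rightarrow> 'h::{real_inner, banach}) \<Rightarrow> bool" where
  "orthonormal_basis e \<longleftrightarrow>
     (\<forall>m n. e m \<bullet> e n = (if m = n then 1 else 0)) \<and> closure (span (range e)) = UNIV"

text \<open>The last conjunct says that the graph of \<open>A\<close> equals the graph of its adjoint.\<close>

definition self_adjoint_operator :: "'h::{real_inner, banach} set \<Rightarrow> ('h \<Rightarrow> 'h) \<Rightarrow> bool" where
  "self_adjoint_operator D A \<longleftrightarrow>
     subspace D \<and> closure D = UNIV \<and>
     (\<forall>x\<in>D. \<forall>y\<in>D. A (x + y) = A x + A y) \<and> (\<forall>c. \<forall>x\<in>D. A (c *\<^sub>R x) = c *\<^sub>R A x) \<and>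
     (\<forall>y z. (y \<in> D \<and> A y = z) \<longleftrightarrow> (\<forall>x\<in>D. A x \<bullet> y = x \<bullet> z))"

definition C0_semigroup :: "(real \<Rightarrow> 'h::real_normed_vector \<Rightarrow> 'h) \<Rightarrow> bool" where
  "C0_semigroup S \<longleftrightarrow>
     (\<forall>t\<ge>0. bounded_linear (S t)) \<and> (\<forall>x. S 0 x = x) \<and>
     (\<forall>s\<ge>0. \<forall>t\<ge>0. \<forall>x. S (s + t) x = S s (S t x)) \<and>
     (\<forall>x. continuous_on {0..} (\<lambda>t. S t x))"

text \<open>\<open>S\<close> is the semigroup \<open>t \<mapsto> exp (t A)\<close>: its infinitesimal generator is \<open>A\<close> with
  domain exactly \<open>D\<close>.\<close>

definition semigroup_generated_by ::
    "(real \<Rightarrow> 'h::real_normed_vector \<Rightarrow> 'h) \<Rightarrow> 'h set \<Rightarrow> ('h \<Rightarrow> 'h) \<Rightarrow> bool" where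
  "semigroup_generated_by S D A \<longleftrightarrow>
     C0_semigroup S \<and>
     (\<forall>x y. (x \<in> D \<and> A x = y) \<longleftrightarrow> ((\<lambda>h. (S h x - x) /\<^sub>R h) \<longlongrightarrow> y) (at_right 0))"

definition usual_stochastic_basis :: "'a measure \<Rightarrow> (real \<Rightarrow> 'a measure) \<Rightarrow> bool" where
  "usual_stochastic_basis M F \<longleftrightarrow>
     prob_space M \<and> complete_measure M \<and>
     (\<forall>t\<ge>0. subalgebra M (F t)) \<and>
     (\<forall>s\<ge>0. \<forall>t\<ge>s. sets (F s) \<subseteq> sets (F t)) \<and>
     (\<forall>t\<ge>0. sets (F t) = (\<Inter>s\<in>{t<..}. sets (F s))) \<and>
     null_sets M \<subseteq> sets (F 0)"

definition levy_process :: "'a measure \<Rightarrow> (real \<Rightarrow> 'a \<Rightarrow> real) \<Rightarrow> bool" where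
  "levy_process M Z \<longleftrightarrow>
     (\<forall>t\<ge>0. Z t \<in> borel_measurable M) \<and>
     (AE \<omega> in M. Z 0 \<omega> = 0) \<and>
     (\<forall>(\<tau>::nat \<Rightarrow> real) N. 0 \<le> \<tau> 0 \<and> (\<forall>i<N. \<tau> i \<le> \<tau> (Suc i)) \<longrightarrow>
        prob_space.indep_vars M (\<lambda>_. borel) (\<lambda>i \<omega>. Z (\<tau> (Suc i)) \<omega> - Z (\<tau> i) \<omega>) {..<N}) \<and>
     (\<forall>s\<ge>0. \<forall>h\<ge>0. distr M borel (\<lambda>\<omega>. Z (s + h) \<omega> - Z s \<omega>) = distr M borel (Z h)) \<and>
     (\<forall>t\<ge>0. \<forall>\<epsilon>>0. ((\<lambda>s. measure M {\<omega>\<in>space M. \<bar>Z s \<omega> - Z t \<omega>\<bar> > \<epsilon>}) \<longlongrightarrow> 0) (at t within {0..})) \<and>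
     (AE \<omega> in M. (\<forall>t\<ge>0. continuous (at_right t) (\<lambda>s. Z s \<omega>)) \<and>
                 (\<forall>t>0. \<exists>l. ((\<lambda>s. Z s \<omega>) \<longlongrightarrow> l) (at_left t)))"

definition symmetric_stable_levy_process ::
    "'a measure \<Rightarrow> real \<Rightarrow> (real \<Rightarrow> 'a \<Rightarrow> real) \<Rightarrow> bool" where
  "symmetric_stable_levy_process M \<alpha> Z \<longleftrightarrow>
     levy_process M Z \<and>
     (\<forall>t\<ge>0. \<forall>h. char (distr M borel (Z t)) h = complex_of_real (exp (- t * \<bar>h\<bar> powr \<alpha>)))"

text \<open>Independence of whole processes, i.e. of the path-valued random variables.\<close>

definition independent_processes :: "'a measure \<Rightarrow> (nat \<Rightarrow> real \<Rightarrow> 'a \<Rightarrow> real) \<Rightarrow> bool" where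
  "independent_processes M Z \<longleftrightarrow>
     prob_space.indep_vars M (\<lambda>_. \<Pi>\<^sub>M t\<in>{0..}. borel) (\<lambda>n \<omega>. \<lambda>t\<in>{0..}. Z n t \<omega>) UNIV"

definition adapted_process ::
    "(real \<Rightarrow> 'a measure) \<Rightarrow> (real \<Rightarrow> 'a \<Rightarrow> 'b::topological_space) \<Rightarrow> bool" where
  "adapted_process F X \<longleftrightarrow> (\<forall>t\<ge>0. X t \<in> borel_measurable (F t))"

text \<open>The \<open>\<sigma>\<close>-algebra generated by all increments \<open>Z n t - Z n s\<close>, \<open>t \<ge> s\<close>, jointly in \<open>n\<close>.\<close>

definition increments_after ::
    "'a measure \<Rightarrow> (nat \<Rightarrow> real \<Rightarrow> 'a \<Rightarrow> real) \<Rightarrow> real \<Rightarrow> 'a measure" where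
  "increments_after M Z s =
     vimage_algebra (space M) (\<lambda>\<omega>. \<lambda>(n, t)\<in>UNIV \<times> {s..}. Z n t \<omega> - Z n s \<omega>)
       (\<Pi>\<^sub>M _\<in>UNIV \<times> {s..}. borel)"

definition increments_independent_of_past ::
    "'a measure \<Rightarrow> (real \<Rightarrow> 'a measure) \<Rightarrow> (nat \<Rightarrow> real \<Rightarrow> 'a \<Rightarrow> real) \<Rightarrow> bool" where
  "increments_independent_of_past M F Z \<longleftrightarrow>
     (\<forall>s\<ge>0. prob_space.indep_set M (sets (F s)) (sets (increments_after M Z s)))"

definition partition_of :: "real \<Rightarrow> real \<Rightarrow> nat \<Rightarrow> (nat \<Rightarrow> real) \<Rightarrow> bool" where
  "partition_of a b N p \<longleftrightarrow> p 0 = a \<and> p N = b \<and> (\<forall>i<N. p i \<le> p (Suc i))"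

definition ito_sum ::
    "(real \<Rightarrow> 'b::real_vector) \<Rightarrow> (real \<Rightarrow> 'a \<Rightarrow> real) \<Rightarrow> nat \<Rightarrow> (nat \<Rightarrow> real) \<Rightarrow> 'a \<Rightarrow> 'b" where
  "ito_sum f W N p \<omega> = (\<Sum>i<N. (W (p (Suc i)) \<omega> - W (p i) \<omega>) *\<^sub>R f (p i))"

text \<open>The integral over \<open>[a, b]\<close> of a deterministic continuous integrand \<open>f\<close> against \<open>W\<close>: the
  limit in probability of the left-endpoint sums as the mesh of the partition tends to \<open>0\<close>. For
  continuous integrands and semimartingale integrators this agrees with the Ito integral.\<close>

definition has_stochastic_integral ::
    "'a measure \<Rightarrow> (real \<Rightarrow> 'a \<Rightarrow> real) \<Rightarrow> (real \<Rightarrow> 'b::real_normed_vector) \<Rightarrow> real \<Rightarrow> real \<Rightarrow>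
     ('a \<Rightarrow> 'b) \<Rightarrow> bool" where
  "has_stochastic_integral M W f a b I \<longleftrightarrow>
     I \<in> borel_measurable M \<and>
     (\<forall>\<epsilon>>0. \<exists>\<delta>>0. \<forall>N p. partition_of a b N p \<and> (\<forall>i<N. p (Suc i) - p i < \<delta>) \<longrightarrow>
        measure M {\<omega>\<in>space M. dist (ito_sum f W N p \<omega>) (I \<omega>) > \<epsilon>} < \<epsilon>)"

text \<open>The integral is determined only up to almost sure equality; \<open>SOME\<close> picks a version. Under
  the usual conditions all versions have the same measurability with respect to the filtration.\<close>

definition stochastic_integral ::
    "'a measure \<Rightarrow> (real \<Rightarrow> 'a \<Rightarrow> real) \<Rightarrow> (real \<Rightarrow> 'b::real_normed_vector) \<Rightarrow> real \<Rightarrow> real \<Rightarrow>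
     'a \<Rightarrow> 'b" where
  "stochastic_integral M W f a b = (SOME I. has_stochastic_integral M W f a b I)"

text \<open>The integral of an operator-valued \<open>\<Phi>\<close> against the formal series
  \<open>\<Sum>n. \<beta> n * Z n t *\<^sub>R e n\<close>: the sum of the \<open>'h\<close>-valued integrals of \<open>\<Phi> s (\<beta> n *\<^sub>R e n)\<close>
  against \<open>Z n\<close>.\<close>

definition cylindrical_integral ::
    "'a measure \<Rightarrow> (nat \<Rightarrow> real \<Rightarrow> 'a \<Rightarrow> real) \<Rightarrow> (nat \<Rightarrow> real) \<Rightarrow> (nat \<Rightarrow> 'h::{real_inner, banach}) \<Rightarrow>
     (real \<Rightarrow> 'h \<Rightarrow> 'h) \<Rightarrow> real \<Rightarrow> real \<Rightarrow> 'a \<Rightarrow> 'h" where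
  "cylindrical_integral M Z \<beta> e \<Phi> a b \<omega> =
     (\<Sum>n. stochastic_integral M (Z n) (\<lambda>s. \<Phi> s (\<beta> n *\<^sub>R e n)) a b \<omega>)"

definition conv_coord ::
    "'a measure \<Rightarrow> (nat \<Rightarrow> real \<Rightarrow> 'a \<Rightarrow> real) \<Rightarrow> (nat \<Rightarrow> real) \<Rightarrow> (nat \<Rightarrow> real) \<Rightarrow>
     real \<Rightarrow> nat \<Rightarrow> 'a \<Rightarrow> real" where
  "conv_coord M Z \<beta> \<gamma> t n = stochastic_integral M (Z n) (\<lambda>s. exp (- \<gamma> n * (t - s)) * \<beta> n) 0 t"

definition ou_coord ::
    "'a measure \<Rightarrow> (nat \<Rightarrow> real \<Rightarrow> 'a \<Rightarrow> real) \<Rightarrow> (nat \<Rightarrow> real) \<Rightarrow> (nat \<Rightarrow> real) \<Rightarrow>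
     (nat \<Rightarrow> 'h::{real_inner, banach}) \<Rightarrow> 'h \<Rightarrow> real \<Rightarrow> nat \<Rightarrow> 'a \<Rightarrow> real" where
  "ou_coord M Z \<beta> \<gamma> e x t n \<omega> = exp (- \<gamma> n * t) * (x \<bullet> e n) + conv_coord M Z \<beta> \<gamma> t n \<omega>"

text \<open>The element of \<open>'h\<close> with coordinates \<open>ou_coord\<close>; where the series diverges this is some
  fixed junk value.\<close>

definition ou_process ::
    "'a measure \<Rightarrow> (nat \<Rightarrow> real \<Rightarrow> 'a \<Rightarrow> real) \<Rightarrow> (nat \<Rightarrow> real) \<Rightarrow> (nat \<Rightarrow> real) \<Rightarrow>
     (nat \<Rightarrow> 'h::{real_inner, banach}) \<Rightarrow> 'h \<Rightarrow> real \<Rightarrow> 'a \<Rightarrow> 'h" where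
  "ou_process M Z \<beta> \<gamma> e x t \<omega> = (\<Sum>n. ou_coord M Z \<beta> \<gamma> e x t n \<omega> *\<^sub>R e n)"

definition takes_values_in_H ::
    "'a measure \<Rightarrow> (real \<Rightarrow> nat \<Rightarrow> 'a \<Rightarrow> real) \<Rightarrow> bool" where
  "takes_values_in_H M X \<longleftrightarrow> (\<forall>t\<ge>0. AE \<omega> in M. summable (\<lambda>n. (X t n \<omega>)\<^sup>2))"

text \<open>\<open>X x\<close> is the process started at \<open>x\<close>; the transition operators are
  \<open>(R\<^sub>h f) y = E (f (X y h))\<close>.\<close>

definition markovian ::
    "'a measure \<Rightarrow> (real \<Rightarrow> 'a measure) \<Rightarrow> ('h::topological_space \<Rightarrow> real \<Rightarrow> 'a \<Rightarrow> 'h) \<Rightarrow> bool" where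
  "markovian M F X \<longleftrightarrow>
     (\<forall>x. \<forall>t\<ge>0. \<forall>h\<ge>0. \<forall>f::'h \<Rightarrow> real. f \<in> borel_measurable borel \<and> bounded (range f) \<longrightarrow>
        (AE \<omega> in M. real_cond_exp M (F t) (\<lambda>\<omega>'. f (X x (t + h) \<omega>')) \<omega>
                   = (\<integral>\<omega>'. f (X (X x t \<omega>) h \<omega>') \<partial>M)))"

end

theory Submission
  imports Defs
begin

text \<open>Everything rests on one computation. If \<open>X\<close> has characteristic function \<open>exp (- c \<bar>u\<bar>\<^sup>\<alpha>)\<close> and \<open>G\<close> is
  an independent standard Gaussian, then \<open>E (1 - exp (- X\<^sup>2 / 2)) = E (1 - exp (- c \<bar>G\<bar>\<^sup>\<alpha>))\<close>, which lies
  between constant multiples of \<open>1 - exp (- c)\<close> and \<open>c\<close>. Applied to differences of left-endpoint sums,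
  whose scale \<open>c\<close> is small for fine partitions, it gives the existence of the integrals. Applied to the
  coordinates, which are independent and stable with scale comparable to \<open>\<beta>\<^sub>n\<^sup>\<alpha> / \<gamma>\<^sub>n\<close>, it gives both
  directions of the criterion: a Borel--Cantelli type sum for sufficiency, an infinite product for
  necessity. For the Markov property, \<open>X\<^sub>t\<^sub>+\<^sub>h = exp (h A) X\<^sub>t + V\<close> where \<open>V\<close> is a function of the increments
  after \<open>t\<close>, hence independent of the past, and has the law of \<open>Z\<^sub>A(h)\<close>.\<close>

subsection \<open>Stable random variables against a Gaussian average\<close>

text \<open>The expectation of \<open>square_defect\<close> takes the place of the second moment:
  the integrand is bounded, it controls probabilities through Markov's inequality, and it is
  determined by the characteristic function. A second obstacle is that
  \<open>stochastic_integral\<close> is an arbitrary version picked by \<open>SOME\<close>, so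
  neither independence of the coordinates nor measurability with respect to a smaller sigma-algebra
  can be read off from it. Both are proved for explicit versions, pointwise limits of left-endpoint
  sums along fixed partitions, and their consequences are carried over along almost sure
  equality.\<close>

definition (in prob_space) stable_rv :: "real \<Rightarrow> real \<Rightarrow> ('a \<Rightarrow> real) \<Rightarrow> bool" where
  "stable_rv \<alpha> c X \<longleftrightarrow>
     X \<in> borel_measurable M \<and> (\<forall>u. char (distr M borel X) u = complex_of_real (exp (- c * \<bar>u\<bar> powr \<alpha>)))"

lemma (in prob_space) stable_rv_measurable: "stable_rv \<alpha> c X \<Longrightarrow> X \<in> borel_measurable M"
  by (simp add: stable_rv_def)

lemma (in prob_space) stable_rv_distr_unique:
  assumes "stable_rv \<alpha> c X" "stable_rv \<alpha> c Y"
  shows "distr M borel X = distr M borel Y"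
  using assms by (intro Levy_uniqueness real_distribution_distr) (auto simp: stable_rv_def)

text \<open>\<open>exp (- x\<^sup>2 / 2)\<close> is the characteristic function of a standard Gaussian, so by Fubini its
  expectation is a Gaussian average of the characteristic function of \<open>X\<close>.\<close>

lemma (in prob_space) expectation_exp_square_stable:
  assumes X: "stable_rv \<alpha> c X"
  shows "(\<integral>\<omega>. exp (- (X \<omega>)\<^sup>2 / 2) \<partial>M) = (\<integral>g. exp (- c * \<bar>g\<bar> powr \<alpha>) \<partial>std_normal_distribution)"
proof -
  interpret N: real_distribution std_normal_distribution
    by (rule real_dist_normal_dist)
  interpret P: pair_sigma_finite M std_normal_distribution ..
  have [measurable]: "X \<in> borel_measurable M"
    using X by (simp add: stable_rv_def)
  interpret MN: prob_space "M \<Otimes>\<^sub>M std_normal_distribution"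
    by (intro prob_space_pair) (unfold_locales)
  have int: "integrable (M \<Otimes>\<^sub>M std_normal_distribution) (\<lambda>(\<omega>, g). iexp (X \<omega> * g))"
    by (intro MN.integrable_const_bound[where B=1])
       (auto simp del: of_real_mult simp: norm_exp_i_times)
  have "complex_of_real (\<integral>\<omega>. exp (- (X \<omega>)\<^sup>2 / 2) \<partial>M) = (\<integral>\<omega>. char std_normal_distribution (X \<omega>) \<partial>M)"
    by (simp add: char_std_normal_distribution)
  also have "\<dots> = (\<integral>\<omega>. (\<integral>g. iexp (X \<omega> * g) \<partial>std_normal_distribution) \<partial>M)"
    by (simp add: char_def)
  also have "\<dots> = (\<integral>g. (\<integral>\<omega>. iexp (X \<omega> * g) \<partial>M) \<partial>std_normal_distribution)"
    using P.Fubini_integral[OF int] by simp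
  also have "\<dots> = (\<integral>g. char (distr M borel X) g \<partial>std_normal_distribution)"
    by (simp add: char_def integral_distr mult.commute)
  also have "\<dots> = complex_of_real (\<integral>g. exp (- c * \<bar>g\<bar> powr \<alpha>) \<partial>std_normal_distribution)"
    using X by (simp only: stable_rv_def integral_complex_of_real)
  finally show ?thesis
    by (simp only: of_real_eq_iff)
qed

section \<open>A bounded substitute for the square\<close>

text \<open>One minus the Gaussian characteristic function at \<open>x\<close>. It is even,
  increasing in the absolute value and comparable with \<open>min 1 (x^2)\<close>, hence small in
  expectation exactly when the variable is small in probability.\<close>

definition square_defect :: "real \<Rightarrow> real" where
  "square_defect x = 1 - exp (- x\<^sup>2 / 2)"

lemma square_defect_nonneg: "0 \<le> square_defect x"
  and square_defect_le_1: "square_defect x \<le> 1"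
  by (auto simp: square_defect_def)

lemma square_defect_measurable [measurable]: "square_defect \<in> borel_measurable borel"
  unfolding square_defect_def[abs_def] by measurable

lemma isCont_square_defect: "isCont square_defect x"
  unfolding square_defect_def[abs_def] by (intro continuous_intros) auto

lemma square_defect_pos: "x \<noteq> 0 \<Longrightarrow> 0 < square_defect x"
  by (auto simp: square_defect_def)

lemma square_defect_mono: "\<bar>x\<bar> \<le> \<bar>y\<bar> \<Longrightarrow> square_defect x \<le> square_defect y"
  by (auto simp: square_defect_def abs_le_square_iff)

text \<open>From exp(-y) \<le> 1/(1 + y) with y = x^2/2. The constant 4 is convenient rather than
  sharp.\<close>

lemma min_square_le_square_defect: "min 1 (x\<^sup>2) \<le> 4 * square_defect x"
proof -
  have e: "exp (-y) \<le> 1 / (1 + y)" if "0 \<le> y" for y :: real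
    using exp_ge_add_one_self[of y] that by (simp add: exp_minus field_simps)
  have "exp (- (x\<^sup>2 / 2)) \<le> 1 / (1 + x\<^sup>2 / 2)" by (rule e) simp
  moreover have "1 / (1 + x\<^sup>2 / 2) \<le> 1 - min 1 (x\<^sup>2) / 4"
  proof -
    define y where "y = x\<^sup>2"
    have y: "0 \<le> y" by (simp add: y_def)
    have "1 / (1 + y / 2) \<le> 1 - min 1 y / 4"
    proof (cases "y \<le> 1")
      case True
      then have "y * y \<le> 1 * y" using y by (intro mult_right_mono) auto
      then show ?thesis using y True by (simp add: field_simps)
    qed (use y in \<open>simp add: field_simps\<close>)
    then show ?thesis by (simp add: y_def)
  qed
  ultimately show ?thesis by (simp add: square_defect_def)
qed

lemma (in prob_space) integrable_square_defect:
  "X \<in> borel_measurable M \<Longrightarrow> integrable M (\<lambda>\<omega>. square_defect (X \<omega>))"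
  by (intro integrable_const_bound[where B=1])
     (auto simp: square_defect_nonneg square_defect_le_1)

text \<open>The replacement for Chebyshev's inequality: Markov's inequality for
  \<open>square_defect (X \<omega>)\<close>, which is monotone in the absolute value of
  \<open>X \<omega>\<close>.\<close>

lemma (in prob_space) prob_gt_le_square_defect:
  assumes [measurable]: "X \<in> borel_measurable M" and "0 < \<epsilon>"
  shows "prob {\<omega>\<in>space M. \<bar>X \<omega>\<bar> > \<epsilon>} \<le> expectation (\<lambda>\<omega>. square_defect (X \<omega>)) / square_defect \<epsilon>"
proof -
  have "prob {\<omega>\<in>space M. \<bar>X \<omega>\<bar> > \<epsilon>} \<le> prob {\<omega>\<in>space M. square_defect (X \<omega>) \<ge> square_defect \<epsilon>}"
    by (intro finite_measure_mono) (use \<open>0 < \<epsilon>\<close> in \<open>auto intro!: square_defect_mono\<close>)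
  also have "\<dots> \<le> expectation (\<lambda>\<omega>. square_defect (X \<omega>)) / square_defect \<epsilon>"
    by (intro integral_Markov_inequality_measure[where A="{}"])
       (use \<open>0 < \<epsilon>\<close> in \<open>auto intro!: integrable_square_defect square_defect_pos simp: square_defect_nonneg\<close>)
  finally show ?thesis .
qed

lemma (in prob_space) expectation_square_defect_stable:
  assumes X: "stable_rv \<alpha> c X" and c: "0 \<le> c"
  shows "expectation (\<lambda>\<omega>. square_defect (X \<omega>))
           = (\<integral>g. 1 - exp (- c * \<bar>g\<bar> powr \<alpha>) \<partial>std_normal_distribution)"
proof -
  interpret N: real_distribution std_normal_distribution
    by (rule real_dist_normal_dist)
  have [measurable]: "X \<in> borel_measurable M" using X by (simp add: stable_rv_def)
  have i1: "integrable M (\<lambda>\<omega>. exp (- (X \<omega>)\<^sup>2 / 2))"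
    by (intro integrable_const_bound[where B=1]) auto
  have i2: "integrable std_normal_distribution (\<lambda>g. exp (- c * \<bar>g\<bar> powr \<alpha>))"
    by (intro N.integrable_const_bound[where B=1]) (use c in auto)
  show ?thesis
    using expectation_exp_square_stable[OF X] i1 i2 N.prob_space
    by (simp add: square_defect_def prob_space)
qed

text \<open>With 1 - exp(-y) \<le> y and the bound 1 + g^2 for the \<alpha>-th power of the absolute
  value of g, the Gaussian average is at most c E(1 + G^2). This is where the factor 2 comes
  from.\<close>

lemma (in prob_space) expectation_square_defect_stable_le:
  assumes X: "stable_rv \<alpha> c X" and c: "0 \<le> c" and \<alpha>: "0 < \<alpha>" "\<alpha> < 2"
  shows "expectation (\<lambda>\<omega>. square_defect (X \<omega>)) \<le> 2 * c"
proof -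
  interpret N: real_distribution std_normal_distribution
    by (rule real_dist_normal_dist)
  have sq: "integrable std_normal_distribution (\<lambda>g. g^2)" "(\<integral>g. g^2 \<partial>std_normal_distribution) = 1"
    using std_normal_distribution_even_moments[of 1] by auto
  have "(\<integral>g. 1 - exp (- c * \<bar>g\<bar> powr \<alpha>) \<partial>std_normal_distribution)
          \<le> (\<integral>g. c * (1 + g^2) \<partial>std_normal_distribution)"
  proof (intro integral_mono)
    show "integrable std_normal_distribution (\<lambda>g. 1 - exp (- c * \<bar>g\<bar> powr \<alpha>))"
      by (intro N.integrable_const_bound[where B=1]) (use c in auto)
    show "integrable std_normal_distribution (\<lambda>g. c * (1 + g^2))"
      using sq by simp
    fix g :: real
    have "\<bar>g\<bar> powr \<alpha> \<le> 1 + g^2"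
    proof (cases "\<bar>g\<bar> \<le> 1")
      case True
      then have "\<bar>g\<bar> powr \<alpha> \<le> 1" using \<alpha> by (intro powr_le1) auto
      then show ?thesis by (simp add: add_increasing2)
    next
      case False
      then have "\<bar>g\<bar> powr \<alpha> \<le> \<bar>g\<bar> powr 2" using \<alpha> by (intro powr_mono) auto
      then show ?thesis using False by simp
    qed
    then have "c * \<bar>g\<bar> powr \<alpha> \<le> c * (1 + g^2)" using c by (intro mult_left_mono)
    then show "1 - exp (- c * \<bar>g\<bar> powr \<alpha>) \<le> c * (1 + g^2)"
      using exp_ge_add_one_self[of "- c * \<bar>g\<bar> powr \<alpha>"] by simp
  qed
  also have "\<dots> = 2 * c" using sq N.prob_space by simp
  finally show ?thesis using expectation_square_defect_stable[OF X c] by simp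
qed

lemma std_normal_tail_pos: "0 < measure std_normal_distribution {g. 1 \<le> \<bar>g\<bar>}"
proof -
  interpret N: real_distribution std_normal_distribution
    by (rule real_dist_normal_dist)
  have "emeasure std_normal_distribution {g. 1 \<le> \<bar>g\<bar>} \<noteq> 0"
  proof
    assume "emeasure std_normal_distribution {g. 1 \<le> \<bar>g\<bar>} = 0"
    then have "{g::real. 1 \<le> \<bar>g\<bar>} \<in> null_sets std_normal_distribution"
      by (intro null_setsI) auto
    then have "AE g in lborel. g \<in> {g::real. 1 \<le> \<bar>g\<bar>} \<longrightarrow> ennreal (std_normal_density g) = 0"
      by (subst (asm) null_sets_density_iff) auto
    \<comment> \<open>The density is strictly positive, so a null tail would make its piece from 1
      to 2 Lebesgue null, although that piece has length 1.\<close>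
    then have "AE g in lborel. g \<notin> {1..2::real}"
    proof eventually_elim
      case (elim g)
      then show ?case using normal_density_pos[of 1 0 g] by (auto simp: ennreal_eq_0_iff)
    qed
    then have "{1..2::real} \<in> null_sets lborel" by (subst AE_iff_null_sets) auto
    then show False by (auto simp: null_sets_def)
  qed
  then show ?thesis by (simp add: N.emeasure_eq_measure zero_less_measure_iff)
qed

text \<open>Where the Gaussian variable has absolute value at least 1, its \<alpha>-th power is at
  least 1 too. The nonnegative contribution of the remaining values is dropped.\<close>

lemma (in prob_space) expectation_square_defect_stable_ge:
  assumes X: "stable_rv \<alpha> c X" and c: "0 \<le> c" and \<alpha>: "0 < \<alpha>"
  shows "measure std_normal_distribution {g. 1 \<le> \<bar>g\<bar>} * (1 - exp (- c))
           \<le> expectation (\<lambda>\<omega>. square_defect (X \<omega>))"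
proof -
  interpret N: real_distribution std_normal_distribution
    by (rule real_dist_normal_dist)
  have "measure std_normal_distribution {g. 1 \<le> \<bar>g\<bar>} * (1 - exp (- c))
      = (\<integral>g. indicator {g. 1 \<le> \<bar>g\<bar>} g * (1 - exp (- c)) \<partial>std_normal_distribution)"
    by simp
  also have "\<dots> \<le> (\<integral>g. 1 - exp (- c * \<bar>g\<bar> powr \<alpha>) \<partial>std_normal_distribution)"
  proof (intro integral_mono)
    show "integrable std_normal_distribution (\<lambda>g. 1 - exp (- c * \<bar>g\<bar> powr \<alpha>))"
      by (intro N.integrable_const_bound[where B=1]) (use c in auto)
    show "integrable std_normal_distribution (\<lambda>g. indicator {g. 1 \<le> \<bar>g\<bar>} g * (1 - exp (- c)))"
      by (intro N.integrable_const_bound[where B=1]) (use c in \<open>auto simp: indicator_def\<close>)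
    fix g :: real
    show "indicator {g. 1 \<le> \<bar>g\<bar>} g * (1 - exp (- c)) \<le> 1 - exp (- c * \<bar>g\<bar> powr \<alpha>)"
    proof (cases "1 \<le> \<bar>g\<bar>")
      case True
      then have "1 \<le> \<bar>g\<bar> powr \<alpha>" using \<alpha> by (intro ge_one_powr_ge_zero) auto
      then have "c * 1 \<le> c * \<bar>g\<bar> powr \<alpha>" using c by (intro mult_left_mono)
      then show ?thesis using True by simp
    qed (use c in simp)
  qed
  finally show ?thesis using expectation_square_defect_stable[OF X c] by simp
qed

subsection \<open>Left-endpoint sums over partitions\<close>

lemma partition_of_mono:
  assumes "partition_of a b N p" "i \<le> j" "j \<le> N"
  shows "p i \<le> p j"
  using assms(2,3,1)
proof (induction j rule: dec_induct)
  case (step j)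
  then show ?case unfolding partition_of_def by (meson Suc_le_lessD le_trans less_or_eq_imp_le order_trans)
qed simp

lemma partition_of_mem: "partition_of a b N p \<Longrightarrow> i \<le> N \<Longrightarrow> p i \<in> {a..b}"
  using partition_of_mono[of a b N p 0 i] partition_of_mono[of a b N p i N]
  by (auto simp: partition_of_def)

lemma partition_of_le: "partition_of a b N p \<Longrightarrow> a \<le> b"
  using partition_of_mem[of a b N p 0] by auto

lemma ex_fine_partition:
  assumes "a \<le> (b::real)" "0 < \<delta>"
  shows "\<exists>N p. partition_of a b N p \<and> (\<forall>i<N. p (Suc i) - p i < \<delta>)"
proof -
  obtain n where n: "(b - a) / \<delta> < real n" using reals_Archimedean2 by blast
  \<comment> \<open>Even a degenerate interval gets at least one cell, because the Archimedean bound
    is strict and \<open>b - a\<close> is nonnegative.\<close>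
  then have "0 < n" using assms by (cases n) (auto simp: field_simps)
  define p where "p i = a + real i * ((b - a) / real n)" for i
  have d: "p (Suc i) - p i = (b - a) / real n" for i
    by (simp add: p_def distrib_right add_divide_distrib)
  have "partition_of a b n p"
    unfolding partition_of_def
  proof (intro conjI allI impI)
    show "p i \<le> p (Suc i)" for i
      using d[of i] assms(1) by (metis diff_ge_0_iff_ge divide_nonneg_nonneg of_nat_0_le_iff)
  qed (use \<open>0 < n\<close> in \<open>auto simp: p_def\<close>)
  moreover have "(b - a) / real n < \<delta>" using n \<open>0 < n\<close> assms by (simp add: field_simps)
  ultimately show ?thesis using d by metis
qed

lemma sum_concat:
  fixes g :: "nat \<Rightarrow> 'b::comm_monoid_add"
  shows "(\<Sum>i<N + K. g i) = (\<Sum>i<N. g i) + (\<Sum>i<K. g (N + i))"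
  by (induction K) (auto simp: add.assoc)

text \<open>Serves the additivity of the integral over adjacent intervals: sums over both pieces and
  over the whole can be taken along one and the same partition.\<close>

lemma partition_of_concat:
  assumes p: "partition_of a b N p" and q: "partition_of b c K q"
  defines "r \<equiv> \<lambda>i. if i \<le> N then p i else q (i - N)"
  shows "partition_of a c (N + K) r"
    and "(\<forall>i<N. p (Suc i) - p i < \<delta>) \<Longrightarrow> (\<forall>i<K. q (Suc i) - q i < \<delta>) \<Longrightarrow>
           (\<forall>i<N + K. r (Suc i) - r i < \<delta>)"
    and "ito_sum f W (N + K) r \<omega> = ito_sum f W N p \<omega> + ito_sum f W K q \<omega>"
proof -
  have r1: "r i = p i" if "i \<le> N" for i using that by (simp add: r_def)
  \<comment> \<open>At \<open>i = 0\<close> this needs that the last point of \<open>p\<close> and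
    the first point of \<open>q\<close> are both \<open>b\<close>.\<close>
  have r2: "r (N + i) = q i" for i using p q by (auto simp: r_def partition_of_def)
  have split: "(\<forall>i<N + K. P i) \<longleftrightarrow> (\<forall>i<N. P i) \<and> (\<forall>i<K. P (N + i))" for P
    by (auto, metis add_diff_inverse_nat nat_add_left_cancel_less)
  have r2': "r (Suc (N + i)) = q (Suc i)" for i using r2[of "Suc i"] by simp
  have r1': "r (Suc i) = p (Suc i)" if "i < N" for i using r1[of "Suc i"] that by simp
  show "partition_of a c (N + K) r"
    using p q r1[of 0] r2[of K] by (auto simp: partition_of_def split r1 r2 r1' r2')
  show "(\<forall>i<N + K. r (Suc i) - r i < \<delta>)"
    if "\<forall>i<N. p (Suc i) - p i < \<delta>" "\<forall>i<K. q (Suc i) - q i < \<delta>"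
    using that by (auto simp: split r1 r2 r1' r2')
  show "ito_sum f W (N + K) r \<omega> = ito_sum f W N p \<omega> + ito_sum f W K q \<omega>"
    unfolding ito_sum_def sum_concat
    by (intro arg_cong2[where f="(+)"] sum.cong) (auto simp: r1 r2 r1' r2')
qed

lemma sum_div_mod:
  fixes g :: "nat \<Rightarrow> nat \<Rightarrow> 'b::comm_monoid_add"
  assumes "0 < K"
  shows "(\<Sum>k<N * K. g (k div K) (k mod K)) = (\<Sum>i<N. \<Sum>j<K. g i j)"
proof (induction N)
  case (Suc N)
  have "(\<Sum>k<N * K + K. g (k div K) (k mod K)) = (\<Sum>i<N. \<Sum>j<K. g i j) + (\<Sum>j<K. g N j)"
    unfolding sum_concat Suc.IH using assms
    by (intro arg_cong2[where f="(+)"] sum.cong) (auto simp: div_add1_eq)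
  then show ?case by (simp add: add.commute)
qed simp

text \<open>An antiderivative stands in for the integral. By the mean value theorem its increment
  over a cell is the cell length times \<open>g z\<close> with \<open>z\<close> in that cell, so
  \<open>g z\<close> differs from the value at the left endpoint by at most \<open>\<eta>\<close>;
  the errors then telescope.\<close>

lemma left_riemann_sum_bound:
  fixes g G :: "real \<Rightarrow> real"
  assumes p: "partition_of a b N p" and mesh: "\<forall>i<N. p (Suc i) - p i < \<delta>"
    and G: "\<And>s. a \<le> s \<Longrightarrow> s \<le> b \<Longrightarrow> (G has_real_derivative g s) (at s)"
    and unif: "\<And>s t. s \<in> {a..b} \<Longrightarrow> t \<in> {a..b} \<Longrightarrow> \<bar>s - t\<bar> < \<delta> \<Longrightarrow> \<bar>g s - g t\<bar> \<le> \<eta>"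
  shows "\<bar>(\<Sum>i<N. g (p i) * (p (Suc i) - p i)) - (G b - G a)\<bar> \<le> \<eta> * (b - a)"
proof -
  have le: "\<bar>g (p i) * (p (Suc i) - p i) - (G (p (Suc i)) - G (p i))\<bar> \<le> \<eta> * (p (Suc i) - p i)"
    if "i < N" for i
  proof (cases "p i = p (Suc i)")
    case False
    have mem: "p i \<in> {a..b}" "p (Suc i) \<in> {a..b}" using partition_of_mem[OF p] that by auto
    have less: "p i < p (Suc i)" using False p that unfolding partition_of_def by fastforce
    obtain z where z: "p i < z" "z < p (Suc i)" "G (p (Suc i)) - G (p i) = (p (Suc i) - p i) * g z"
      using MVT2[of "p i" "p (Suc i)" G g, OF less] G mem by auto
    have "\<bar>g (p i) - g z\<bar> \<le> \<eta>" using unif[of "p i" z] mem z mesh that by fastforce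
    then have "\<bar>g (p i) - g z\<bar> * (p (Suc i) - p i) \<le> \<eta> * (p (Suc i) - p i)"
      using less by (intro mult_right_mono) auto
    moreover have "g (p i) * (p (Suc i) - p i) - (G (p (Suc i)) - G (p i))
        = (g (p i) - g z) * (p (Suc i) - p i)"
      unfolding z(3) by (simp add: algebra_simps)
    then have "\<bar>g (p i) * (p (Suc i) - p i) - (G (p (Suc i)) - G (p i))\<bar>
        = \<bar>g (p i) - g z\<bar> * (p (Suc i) - p i)"
      using less by (simp add: abs_mult)
    ultimately show ?thesis by simp
  qed simp
  have tele: "(\<Sum>i<N. h (p (Suc i)) - h (p i)) = h b - h a" for h :: "real \<Rightarrow> real"
    using p by (simp add: sum_lessThan_telescope[of "\<lambda>i. h (p i)"] partition_of_def)
  have "(\<Sum>i<N. g (p i) * (p (Suc i) - p i)) - (G b - G a)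
      = (\<Sum>i<N. g (p i) * (p (Suc i) - p i) - (G (p (Suc i)) - G (p i)))"
    using tele[of G] by (simp add: sum_subtractf)
  also have "\<bar>\<dots>\<bar> \<le> (\<Sum>i<N. \<eta> * (p (Suc i) - p i))"
    using le by (intro order_trans[OF sum_abs] sum_mono) auto
  also have "\<dots> = \<eta> * (b - a)" using tele[of "\<lambda>x. x"] by (simp add: sum_distrib_left[symmetric])
  finally show ?thesis .
qed

section \<open>Linear combinations of increments of a stable process\<close>

lemma (in prob_space) stable_levyD:
  assumes "symmetric_stable_levy_process M \<alpha> Z"
  shows "0 \<le> t \<Longrightarrow> Z t \<in> borel_measurable M"
    and "0 \<le> \<tau> 0 \<Longrightarrow> (\<And>i. i < N \<Longrightarrow> \<tau> i \<le> \<tau> (Suc i)) \<Longrightarrow>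
           indep_vars (\<lambda>_. borel) (\<lambda>i \<omega>. Z (\<tau> (Suc i)) \<omega> - Z (\<tau> i) \<omega>) {..<N}"
    and "0 \<le> s \<Longrightarrow> s \<le> t \<Longrightarrow> stable_rv \<alpha> (t - s) (\<lambda>\<omega>. Z t \<omega> - Z s \<omega>)"
proof -
  have l: "levy_process M Z"
    and c: "\<And>t h. 0 \<le> t \<Longrightarrow> char (distr M borel (Z t)) h = complex_of_real (exp (- t * \<bar>h\<bar> powr \<alpha>))"
    using assms by (auto simp: symmetric_stable_levy_process_def)
  show m: "Z t \<in> borel_measurable M" if "0 \<le> t" for t
    using l that by (simp add: levy_process_def)
  show "0 \<le> \<tau> 0 \<Longrightarrow> (\<And>i. i < N \<Longrightarrow> \<tau> i \<le> \<tau> (Suc i)) \<Longrightarrow>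
           indep_vars (\<lambda>_. borel) (\<lambda>i \<omega>. Z (\<tau> (Suc i)) \<omega> - Z (\<tau> i) \<omega>) {..<N}"
    using l by (simp add: levy_process_def)
  assume st: "0 \<le> s" "s \<le> t"
  have "distr M borel (\<lambda>\<omega>. Z (s + (t - s)) \<omega> - Z s \<omega>) = distr M borel (Z (t - s))"
    using l st unfolding levy_process_def by (meson diff_ge_0_iff_ge)
  then show "stable_rv \<alpha> (t - s) (\<lambda>\<omega>. Z t \<omega> - Z s \<omega>)"
    using c[of "t - s"] st m[of s] m[of t] by (simp add: stable_rv_def)
qed

text \<open>Characteristic functions of independent summands multiply, so the exponents
  \<open>c\<close> add. A factor \<open>d\<close> multiplies the exponent by
  \<open>\<bar>d\<bar> powr \<alpha>\<close>, which is why a Riemann sum of the \<alpha>-th power of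
  the integrand appears.\<close>

lemma (in prob_space) stable_sum_increments:
  assumes Z: "symmetric_stable_levy_process M \<alpha> Z"
    and \<tau>: "0 \<le> \<tau> 0" "\<And>i. i < N \<Longrightarrow> \<tau> i \<le> \<tau> (Suc i)"
  shows "stable_rv \<alpha> (\<Sum>i<N. \<bar>d i\<bar> powr \<alpha> * (\<tau> (Suc i) - \<tau> i))
           (\<lambda>\<omega>. \<Sum>i<N. d i * (Z (\<tau> (Suc i)) \<omega> - Z (\<tau> i) \<omega>))"
  unfolding stable_rv_def
proof (intro conjI allI)
  have \<tau>0: "0 \<le> \<tau> i" if "i \<le> N" for i
    using that
  proof (induction i)
    case (Suc i) then show ?case using \<tau>(2)[of i] by simp
  qed (use \<tau> in simp)
  have st: "stable_rv \<alpha> (\<tau> (Suc i) - \<tau> i) (\<lambda>\<omega>. Z (\<tau> (Suc i)) \<omega> - Z (\<tau> i) \<omega>)" if "i < N" for i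
    using that \<tau>0[of i] \<tau>(2)[of i] by (intro stable_levyD[OF Z]) auto
  show "(\<lambda>\<omega>. \<Sum>i<N. d i * (Z (\<tau> (Suc i)) \<omega> - Z (\<tau> i) \<omega>)) \<in> borel_measurable M"
    using st by (intro borel_measurable_sum borel_measurable_times) (auto simp: stable_rv_def)
  fix u
  have "indep_vars (\<lambda>_. borel) (\<lambda>i \<omega>. d i * (Z (\<tau> (Suc i)) \<omega> - Z (\<tau> i) \<omega>)) {..<N}"
    by (rule indep_vars_compose2[OF stable_levyD(2)[OF Z]]) (use \<tau> in auto)
  then have "char (distr M borel (\<lambda>\<omega>. \<Sum>i<N. d i * (Z (\<tau> (Suc i)) \<omega> - Z (\<tau> i) \<omega>))) u
      = (\<Prod>i<N. char (distr M borel (\<lambda>\<omega>. d i * (Z (\<tau> (Suc i)) \<omega> - Z (\<tau> i) \<omega>))) u)"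
    by (rule char_distr_sum)
  also have "\<dots> = (\<Prod>i<N. complex_of_real (exp (- (\<bar>d i\<bar> powr \<alpha> * (\<tau> (Suc i) - \<tau> i)) * \<bar>u\<bar> powr \<alpha>)))"
  proof (intro prod.cong refl)
    fix i assume "i \<in> {..<N}"
    then have i: "stable_rv \<alpha> (\<tau> (Suc i) - \<tau> i) (\<lambda>\<omega>. Z (\<tau> (Suc i)) \<omega> - Z (\<tau> i) \<omega>)" using st by simp
    then have [measurable]: "(\<lambda>\<omega>. Z (\<tau> (Suc i)) \<omega> - Z (\<tau> i) \<omega>) \<in> borel_measurable M"
      by (simp add: stable_rv_def)
    have "char (distr M borel (\<lambda>\<omega>. d i * (Z (\<tau> (Suc i)) \<omega> - Z (\<tau> i) \<omega>))) u
        = char (distr M borel (\<lambda>\<omega>. Z (\<tau> (Suc i)) \<omega> - Z (\<tau> i) \<omega>)) (d i * u)"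
      unfolding char_def by (subst (1 2) integral_distr) (auto simp: mult_ac)
    also have "\<dots> = complex_of_real (exp (- (\<tau> (Suc i) - \<tau> i) * \<bar>d i * u\<bar> powr \<alpha>))"
      using i unfolding stable_rv_def by blast
    also have "- (\<tau> (Suc i) - \<tau> i) * \<bar>d i * u\<bar> powr \<alpha>
        = - (\<bar>d i\<bar> powr \<alpha> * (\<tau> (Suc i) - \<tau> i)) * \<bar>u\<bar> powr \<alpha>"
      by (simp add: abs_mult powr_mult algebra_simps)
    finally show "char (distr M borel (\<lambda>\<omega>. d i * (Z (\<tau> (Suc i)) \<omega> - Z (\<tau> i) \<omega>))) u
        = complex_of_real (exp (- (\<bar>d i\<bar> powr \<alpha> * (\<tau> (Suc i) - \<tau> i)) * \<bar>u\<bar> powr \<alpha>))" .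
  qed
  also have "\<dots> = complex_of_real (exp (- (\<Sum>i<N. \<bar>d i\<bar> powr \<alpha> * (\<tau> (Suc i) - \<tau> i)) * \<bar>u\<bar> powr \<alpha>))"
    by (simp only: of_real_prod[symmetric] exp_sum[symmetric] finite_lessThan sum_distrib_right sum_negf[symmetric])
  finally show "char (distr M borel (\<lambda>\<omega>. \<Sum>i<N. d i * (Z (\<tau> (Suc i)) \<omega> - Z (\<tau> i) \<omega>))) u
     = complex_of_real (exp (- (\<Sum>i<N. \<bar>d i\<bar> powr \<alpha> * (\<tau> (Suc i) - \<tau> i)) * \<bar>u\<bar> powr \<alpha>))" .
qed

lemma (in prob_space) stable_ito_sum:
  assumes Z: "symmetric_stable_levy_process M \<alpha> Z" and "0 \<le> a" and p: "partition_of a b N p"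
  shows "stable_rv \<alpha> (\<Sum>i<N. \<bar>f (p i)\<bar> powr \<alpha> * (p (Suc i) - p i)) (ito_sum f Z N p)"
proof -
  have "stable_rv \<alpha> (\<Sum>i<N. \<bar>f (p i)\<bar> powr \<alpha> * (p (Suc i) - p i))
      (\<lambda>\<omega>. \<Sum>i<N. f (p i) * (Z (p (Suc i)) \<omega> - Z (p i) \<omega>))"
    by (rule stable_sum_increments[OF Z]) (use assms in \<open>auto simp: partition_of_def\<close>)
  then show ?thesis by (simp add: ito_sum_def[abs_def] mult.commute)
qed

text \<open>The cells of the common refinement of two partitions are the clamped intervals
  \<open>[cl i (q j), cl i (q (j + 1))]\<close>; listed lexicographically in \<open>(i, j)\<close> they form a single
  partition, so no sorting of the union is needed.\<close>

lemma (in prob_space) ito_sum_diff_stable: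
  assumes Z: "symmetric_stable_levy_process M \<alpha> Z" and \<alpha>: "0 < \<alpha>" and a: "0 \<le> a"
    and p: "partition_of a b N p" "\<forall>i<N. p (Suc i) - p i < \<delta>"
    and q: "partition_of a b K q" "\<forall>i<K. q (Suc i) - q i < \<delta>"
    and unif: "\<And>s t. s \<in> {a..b} \<Longrightarrow> t \<in> {a..b} \<Longrightarrow> \<bar>s - t\<bar> < \<delta> \<Longrightarrow> \<bar>f s - f t\<bar> \<le> \<eta>"
  shows "\<exists>c. 0 \<le> c \<and> c \<le> \<eta> powr \<alpha> * (b - a) \<and>
    stable_rv \<alpha> c (\<lambda>\<omega>. ito_sum f Z N p \<omega> - ito_sum f Z K q \<omega>)"
proof -
  define cl where "cl i x = max (p i) (min (p (Suc i)) x)" for i x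
  have p_mono: "p i \<le> p (Suc i)" if "i < N" for i using p that by (simp add: partition_of_def)
  have q_mono: "q i \<le> q (Suc i)" if "i < K" for i using q that by (simp add: partition_of_def)
  have ends: "p 0 = a" "p N = b" "q 0 = a" "q K = b" using p q by (auto simp: partition_of_def)
  have pm: "p i \<in> {a..b}" if "i \<le> N" for i using partition_of_mem[OF p(1) that] .
  have qm: "q i \<in> {a..b}" if "i \<le> K" for i using partition_of_mem[OF q(1) that] .
  have cl_a: "cl i a = p i" if "i < N" for i
    using p_mono[OF that] pm[of i] that by (auto simp: cl_def)
  have cl_b: "cl i b = p (Suc i)" if "i < N" for i
    using p_mono[OF that] pm[of "Suc i"] that by (auto simp: cl_def)
  have tele_j: "(\<Sum>j<K. W (cl i (q (Suc j))) - W (cl i (q j))) = W (p (Suc i)) - W (p i)"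
    if "i < N" for i and W :: "real \<Rightarrow> real"
    using sum_lessThan_telescope[of "\<lambda>j. W (cl i (q j))" K] cl_a[OF that] cl_b[OF that]
    by (simp add: ends)
  have tele_i: "(\<Sum>i<N. W (cl i y) - W (cl i x)) = W y - W x"
    if "x \<in> {a..b}" "y \<in> {a..b}" for x y and W :: "real \<Rightarrow> real"
  proof -
    \<comment> \<open>Clamping to one cell is rewritten as a difference of truncations from above at
      consecutive points of \<open>p\<close>. In this form the sum over the cells
      telescopes.\<close>
    have *: "W (cl i x) - W (p i) = W (min x (p (Suc i))) - W (min x (p i))" if "i < N" for i x
      using p_mono[OF that] by (auto simp: cl_def max_def min_def)
    have "(\<Sum>i<N. W (cl i y) - W (cl i x)) = (\<Sum>i<N. (W (min y (p (Suc i))) - W (min y (p i)))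
         - (W (min x (p (Suc i))) - W (min x (p i))))"
      using * by (intro sum.cong) (auto simp flip: *)
    also have "\<dots> = (W (min y b) - W (min y a)) - (W (min x b) - W (min x a))"
      unfolding sum_subtractf using sum_lessThan_telescope[of "\<lambda>i. W (min y (p i))" N]
        sum_lessThan_telescope[of "\<lambda>i. W (min x (p i))" N] by (simp add: sum_subtractf ends)
    also have "\<dots> = W y - W x" using that by (simp add: min_absorb1 min_absorb2)
    finally show ?thesis .
  qed
  have diff: "ito_sum f Z N p \<omega> - ito_sum f Z K q \<omega>
    = (\<Sum>i<N. \<Sum>j<K. (f (p i) - f (q j)) * (Z (cl i (q (Suc j))) \<omega> - Z (cl i (q j)) \<omega>))" for \<omega>
  proof -
    have "ito_sum f Z N p \<omega>
        = (\<Sum>i<N. \<Sum>j<K. f (p i) * (Z (cl i (q (Suc j))) \<omega> - Z (cl i (q j)) \<omega>))"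
      unfolding ito_sum_def sum_distrib_left[symmetric]
      by (intro sum.cong refl) (simp add: tele_j[of _ "\<lambda>t. Z t \<omega>"])
    moreover have "ito_sum f Z K q \<omega>
        = (\<Sum>j<K. \<Sum>i<N. f (q j) * (Z (cl i (q (Suc j))) \<omega> - Z (cl i (q j)) \<omega>))"
      unfolding ito_sum_def sum_distrib_left[symmetric]
    proof (intro sum.cong refl)
      fix j assume "j \<in> {..<K}"
      then show "(Z (q (Suc j)) \<omega> - Z (q j) \<omega>) *\<^sub>R f (q j)
          = f (q j) * (\<Sum>i<N. Z (cl i (q (Suc j))) \<omega> - Z (cl i (q j)) \<omega>)"
        using tele_i[of "q j" "q (Suc j)" "\<lambda>t. Z t \<omega>"] qm[of j] qm[of "Suc j"] by simp
    qed
    ultimately show ?thesis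
      by (simp add: sum.swap[of _ "{..<K}"] sum_subtractf left_diff_distrib)
  qed
  show ?thesis
  \<comment> \<open>\<open>K = 0\<close> means \<open>a = b\<close>, and all inner sums are empty.
    Otherwise \<open>K\<close> may serve as divisor in the row and column indices.\<close>
  proof (cases "K = 0")
    case True
    then have "(\<lambda>\<omega>. ito_sum f Z N p \<omega> - ito_sum f Z K q \<omega>) = (\<lambda>_. 0)"
      unfolding diff by simp
    then have "stable_rv \<alpha> 0 (\<lambda>\<omega>. ito_sum f Z N p \<omega> - ito_sum f Z K q \<omega>)"
      by (simp add: stable_rv_def char_def integral_distr prob_space del: distr_const)
    then show ?thesis using partition_of_le[OF p(1)] by (intro exI[of _ 0]) auto
  next
    case False
    then have K: "0 < K" by simp
    \<comment> \<open>The default value \<open>b\<close> supplies the right endpoint of the very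
      last cell, at index \<open>N * K\<close>.\<close>
    define \<tau> where "\<tau> k = (if k < N * K then cl (k div K) (q (k mod K)) else b)" for k
    define d where "d k = f (p (k div K)) - f (q (k mod K))" for k
    have ij: "k div K < N" "k mod K < K" if "k < N * K" for k
      using that K by (auto simp: less_mult_imp_div_less)
    have \<tau>_Suc: "\<tau> (Suc k) = cl (k div K) (q (Suc (k mod K)))" if k: "k < N * K" for k
    \<comment> \<open>At a change of row the last point of row i is \<open>p (Suc i)\<close>, which
      is also the first point of the next row; hence the rows join into one sequence.\<close>
    proof (cases "Suc (k mod K) = K")
      case True
      then have eq: "Suc k = Suc (k div K) * K"
        by (metis add.commute add_Suc_right div_mult_mod_eq mult_Suc)
      have b: "cl (k div K) (q (Suc (k mod K))) = p (Suc (k div K))"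
        using True cl_b[OF ij(1)[OF k]] by (simp add: ends)
      show ?thesis
      proof (cases "Suc (k div K) < N")
        case True
        then have "Suc k < N * K" unfolding eq using K by (intro mult_less_mono1)
        moreover have "Suc k div K = Suc (k div K)" "Suc k mod K = 0" unfolding eq using K by auto
        ultimately show ?thesis using b cl_a[OF True] by (simp add: \<tau>_def ends)
      next
        case False
        then have "Suc (k div K) = N" using ij(1)[OF k] by simp
        then show ?thesis using b eq by (simp add: \<tau>_def ends)
      qed
    next
      case False
      then have s: "Suc k mod K = Suc (k mod K)" "Suc k div K = k div K"
        by (auto simp: mod_Suc div_Suc)
      have "Suc k \<noteq> N * K" using False s by (metis mod_mult_self2_is_0 nat.distinct(1))
      then show ?thesis using s k by (simp add: \<tau>_def)
    qed
    have \<tau>_mono: "\<tau> k \<le> \<tau> (Suc k)" if "k < N * K" for k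
      using q_mono[OF ij(2)[OF that]] that unfolding \<tau>_Suc[OF that]
      by (auto simp: \<tau>_def cl_def max_def min_def)
    have \<tau>0: "0 \<le> \<tau> 0"
      using a cl_a[of 0] partition_of_le[OF p(1)] by (auto simp: \<tau>_def ends K)
    have d_le: "\<bar>d k\<bar> powr \<alpha> * (\<tau> (Suc k) - \<tau> k) \<le> \<eta> powr \<alpha> * (\<tau> (Suc k) - \<tau> k)"
      if k: "k < N * K" for k
    \<comment> \<open>Empty clamped cells contribute nothing. A nonempty one means that the two
      original cells overlap, and then their left endpoints are less than \<open>\<delta>\<close>
      apart.\<close>
    proof (cases "\<tau> (Suc k) = \<tau> k")
      case False
      define i j where "i = k div K" and "j = k mod K"
      have ijk: "i < N" "j < K" using ij[OF k] by (auto simp: i_def j_def)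
      have "cl i (q j) < cl i (q (Suc j))"
        using False \<tau>_mono[OF k] \<tau>_Suc[OF k] k by (simp add: \<tau>_def i_def j_def)
      then have "p i < q (Suc j)" "q j < p (Suc i)"
        using p_mono[OF ijk(1)] q_mono[OF ijk(2)] by (auto simp: cl_def max_def min_def split: if_splits)
      then have "\<bar>p i - q j\<bar> < \<delta>" using p(2) q(2) ijk by fastforce
      then have "\<bar>d k\<bar> \<le> \<eta>"
        using unif[of "p i" "q j"] pm[of i] qm[of j] ijk by (simp add: d_def i_def j_def)
      then have "\<bar>d k\<bar> powr \<alpha> \<le> \<eta> powr \<alpha>" using \<alpha> by (intro powr_mono2) auto
      then show ?thesis using \<tau>_mono[OF k] by (intro mult_right_mono) auto
    qed simp
    define c where "c = (\<Sum>k<N * K. \<bar>d k\<bar> powr \<alpha> * (\<tau> (Suc k) - \<tau> k))"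
    have "stable_rv \<alpha> c (\<lambda>\<omega>. \<Sum>k<N * K. d k * (Z (\<tau> (Suc k)) \<omega> - Z (\<tau> k) \<omega>))"
      unfolding c_def by (rule stable_sum_increments[OF Z]) (use \<tau>0 \<tau>_mono in auto)
    moreover have "(\<Sum>k<N * K. d k * (Z (\<tau> (Suc k)) \<omega> - Z (\<tau> k) \<omega>))
        = ito_sum f Z N p \<omega> - ito_sum f Z K q \<omega>" for \<omega>
      unfolding diff sum_div_mod[OF K, symmetric] by (intro sum.cong) (auto simp: d_def \<tau>_Suc, simp add: \<tau>_def)
    ultimately have "stable_rv \<alpha> c (\<lambda>\<omega>. ito_sum f Z N p \<omega> - ito_sum f Z K q \<omega>)" by simp
    moreover have "0 \<le> c" unfolding c_def using \<tau>_mono by (intro sum_nonneg mult_nonneg_nonneg) auto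
    moreover have "c \<le> \<eta> powr \<alpha> * (b - a)"
    proof -
      have "c \<le> (\<Sum>k<N * K. \<eta> powr \<alpha> * (\<tau> (Suc k) - \<tau> k))"
        unfolding c_def using d_le by (intro sum_mono) auto
      also have "\<dots> = \<eta> powr \<alpha> * (\<tau> (N * K) - \<tau> 0)"
        by (simp add: sum_distrib_left[symmetric] sum_lessThan_telescope)
      also have "\<dots> \<le> \<eta> powr \<alpha> * (b - a)"
        using cl_a[of 0] K by (intro mult_left_mono) (auto simp: \<tau>_def ends partition_of_le[OF p(1)])
      finally show ?thesis .
    qed
    ultimately show ?thesis by blast
  qed
qed

subsection \<open>The stochastic integral\<close>

text \<open>\<open>N'\<close> is kept arbitrary because the lemma is applied to \<open>M\<close>, to
  the space of paths and to any sigma-algebra that measures the increments.\<close>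

lemma ito_sum_measurable:
  fixes f :: "real \<Rightarrow> 'b::{real_normed_vector, second_countable_topology}"
  assumes W: "\<And>t. t \<in> {a..b} \<Longrightarrow> W t \<in> borel_measurable N'" and p: "partition_of a b N p"
  shows "ito_sum f W N p \<in> borel_measurable N'"
proof -
  have "(\<lambda>\<omega>. (W (p (Suc i)) \<omega> - W (p i) \<omega>) *\<^sub>R f (p i)) \<in> borel_measurable N'" if "i < N" for i
  proof -
    have [measurable]: "W (p i) \<in> borel_measurable N'" "W (p (Suc i)) \<in> borel_measurable N'"
      using partition_of_mem[OF p, of i] partition_of_mem[OF p, of "Suc i"] W that by auto
    show ?thesis by measurable
  qed
  then show ?thesis unfolding ito_sum_def[abs_def] by (intro borel_measurable_sum) auto
qed

text \<open>Borel-Cantelli: the tolerances tend to 0 and the probabilities of exceeding them are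
  summable.\<close>

lemma (in prob_space) AE_tendsto_if_prob_summable:
  fixes X :: "nat \<Rightarrow> 'a \<Rightarrow> 'b::{metric_space, second_countable_topology}"
  assumes [measurable]: "\<And>k. X k \<in> borel_measurable M" "I \<in> borel_measurable M"
    and le: "\<And>k. prob {\<omega>\<in>space M. dist (X k \<omega>) (I \<omega>) > (1/2)^k} \<le> (1/2)^k"
  shows "AE \<omega> in M. (\<lambda>k. X k \<omega>) \<longlonglongrightarrow> I \<omega>"
proof -
  have "AE \<omega> in M. \<forall>\<^sub>F k in sequentially. \<omega> \<in> space M - {\<omega>\<in>space M. dist (X k \<omega>) (I \<omega>) > (1/2)^k}"
  proof (rule borel_cantelli_AE1)
    show "summable (\<lambda>k. prob {\<omega>\<in>space M. dist (X k \<omega>) (I \<omega>) > (1/2)^k})"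
      by (rule summable_comparison_test'[of "\<lambda>k. (1/2)^k" 0]) (use le in auto)
  qed (auto simp: less_top[symmetric])
  then show ?thesis
  proof eventually_elim
    case (elim \<omega>)
    then have "\<forall>\<^sub>F k in sequentially. dist (X k \<omega>) (I \<omega>) \<le> (1/2)^k"
      by eventually_elim auto
    moreover have "(\<lambda>k. (1/2)^k :: real) \<longlonglongrightarrow> 0" by (rule LIMSEQ_power_zero) simp
    ultimately have "(\<lambda>k. dist (X k \<omega>) (I \<omega>)) \<longlonglongrightarrow> 0"
      by (rule real_tendsto_sandwich[of "\<lambda>_. 0", rotated 1, OF _ tendsto_const]) auto
    then show ?case by (rule tendsto_dist_iff[THEN iffD2])
  qed
qed

definition fine_partitions ::
    "real \<Rightarrow> real \<Rightarrow> (nat \<Rightarrow> real) \<Rightarrow> (nat \<Rightarrow> nat) \<Rightarrow> (nat \<Rightarrow> nat \<Rightarrow> real) \<Rightarrow> bool" where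
  "fine_partitions a b \<delta> N p \<longleftrightarrow>
     (\<forall>k. partition_of a b (N k) (p k) \<and> (\<forall>i<N k. p k (Suc i) - p k i < \<delta> k))"

lemma fine_partitionsD:
  assumes "fine_partitions a b \<delta> N p"
  shows "partition_of a b (N k) (p k)" "i < N k \<Longrightarrow> p k (Suc i) - p k i < \<delta> k"
  using assms by (auto simp: fine_partitions_def)

lemma fine_partitions_mono:
  "fine_partitions a b \<delta> N p \<Longrightarrow> (\<And>k. \<delta> k \<le> \<delta>' k) \<Longrightarrow> fine_partitions a b \<delta>' N p"
  unfolding fine_partitions_def by (meson less_le_trans)

lemma ex_fine_partitions:
  assumes "a \<le> b" "\<And>k. 0 < \<delta> k"
  shows "\<exists>N p. fine_partitions a b \<delta> N p"
proof -
  have "\<forall>k. \<exists>Np. partition_of a b (fst Np) (snd Np) \<and> (\<forall>i<fst Np. snd Np (Suc i) - snd Np i < \<delta> k)"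
    using ex_fine_partition[OF assms] by auto
  then obtain Np where "\<forall>k. partition_of a b (fst (Np k)) (snd (Np k)) \<and>
      (\<forall>i<fst (Np k). snd (Np k) (Suc i) - snd (Np k) i < \<delta> k)"
    by atomize_elim (rule choice)
  then show ?thesis unfolding fine_partitions_def
    by (intro exI[of _ "\<lambda>k. fst (Np k)"] exI[of _ "\<lambda>k. snd (Np k)"])
qed

text \<open>The lemma provides mesh tolerances rather than a sequence of partitions, so that several
  integrals can be approximated along a common sequence.\<close>

lemma (in prob_space) has_stochastic_integral_AE_limit:
  fixes f :: "real \<Rightarrow> 'b::{real_normed_vector, second_countable_topology}"
  assumes I: "has_stochastic_integral M W f a b I"
    and W: "\<And>t. t \<in> {a..b} \<Longrightarrow> W t \<in> borel_measurable M"
  shows "\<exists>\<delta>. (\<forall>k. 0 < \<delta> k) \<and> (\<forall>N p. fine_partitions a b \<delta> N p \<longrightarrow>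
           (AE \<omega> in M. (\<lambda>k. ito_sum f W (N k) (p k) \<omega>) \<longlonglongrightarrow> I \<omega>))"
proof -
  have "\<forall>k. \<exists>\<delta>>0. \<forall>N p. partition_of a b N p \<and> (\<forall>i<N. p (Suc i) - p i < \<delta>) \<longrightarrow>
        measure M {\<omega>\<in>space M. dist (ito_sum f W N p \<omega>) (I \<omega>) > (1/2)^k} < (1/2)^k"
    using I unfolding has_stochastic_integral_def by simp
  then obtain \<delta> :: "nat \<Rightarrow> real" where \<delta>: "\<forall>k. 0 < \<delta> k \<and>
    (\<forall>N p. partition_of a b N p \<and> (\<forall>i<N. p (Suc i) - p i < \<delta> k) \<longrightarrow>
        measure M {\<omega>\<in>space M. dist (ito_sum f W N p \<omega>) (I \<omega>) > (1/2)^k} < (1/2)^k)"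
    by atomize_elim (rule choice)
  have I_meas: "I \<in> borel_measurable M" using I by (simp add: has_stochastic_integral_def)
  show ?thesis
  proof (intro exI[of _ \<delta>] conjI allI impI)
    fix N p assume p: "fine_partitions a b \<delta> N p"
    show "AE \<omega> in M. (\<lambda>k. ito_sum f W (N k) (p k) \<omega>) \<longlonglongrightarrow> I \<omega>"
    proof (rule AE_tendsto_if_prob_summable)
      show "ito_sum f W (N k) (p k) \<in> borel_measurable M" for k
        by (rule ito_sum_measurable[OF W fine_partitionsD(1)[OF p]])
      show "prob {\<omega>\<in>space M. dist (ito_sum f W (N k) (p k) \<omega>) (I \<omega>) > (1/2)^k} \<le> (1/2)^k" for k
        using \<delta> fine_partitionsD(1)[OF p, of k] fine_partitionsD(2)[OF p, of _ k] by (intro less_imp_le) blast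
    qed (rule I_meas)
  qed (use \<delta> in blast)
qed

text \<open>Both versions are almost sure limits along one sequence of partitions, fine enough for
  either.\<close>

lemma (in prob_space) has_stochastic_integral_unique:
  fixes f :: "real \<Rightarrow> 'b::{real_normed_vector, second_countable_topology}"
  assumes I: "has_stochastic_integral M W f a b I" and J: "has_stochastic_integral M W f a b J"
    and W: "\<And>t. t \<in> {a..b} \<Longrightarrow> W t \<in> borel_measurable M" and ab: "a \<le> b"
  shows "AE \<omega> in M. I \<omega> = J \<omega>"
proof -
  obtain \<delta> where \<delta>: "\<forall>k. 0 < \<delta> k" "\<forall>N p. fine_partitions a b \<delta> N p \<longrightarrow>
           (AE \<omega> in M. (\<lambda>k. ito_sum f W (N k) (p k) \<omega>) \<longlonglongrightarrow> I \<omega>)"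
    using has_stochastic_integral_AE_limit[OF I W] by blast
  obtain \<delta>' where \<delta>': "\<forall>k. 0 < \<delta>' k" "\<forall>N p. fine_partitions a b \<delta>' N p \<longrightarrow>
           (AE \<omega> in M. (\<lambda>k. ito_sum f W (N k) (p k) \<omega>) \<longlonglongrightarrow> J \<omega>)"
    using has_stochastic_integral_AE_limit[OF J W] by blast
  obtain N p where p: "fine_partitions a b (\<lambda>k. min (\<delta> k) (\<delta>' k)) N p"
    using ex_fine_partitions[OF ab, of "\<lambda>k. min (\<delta> k) (\<delta>' k)"] \<delta>(1) \<delta>'(1) by auto
  have "AE \<omega> in M. (\<lambda>k. ito_sum f W (N k) (p k) \<omega>) \<longlonglongrightarrow> I \<omega>"
    using fine_partitions_mono[OF p, of \<delta>] \<delta>(2) by simp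
  moreover have "AE \<omega> in M. (\<lambda>k. ito_sum f W (N k) (p k) \<omega>) \<longlonglongrightarrow> J \<omega>"
    using fine_partitions_mono[OF p, of \<delta>'] \<delta>'(2) by simp
  ultimately show ?thesis by eventually_elim (rule LIMSEQ_unique)
qed

text \<open>Additivity in the interval, in the form needed for the convolution: on the earlier
  interval the kernel for the later time is the kernel for the earlier time multiplied by a damping
  factor \<open>r\<close>.\<close>

lemma (in prob_space) has_stochastic_integral_combine:
  fixes f g :: "real \<Rightarrow> real"
  assumes I: "has_stochastic_integral M W f a b I" and J: "has_stochastic_integral M W g b c J"
    and K: "has_stochastic_integral M W g a c K"
    and fg: "\<And>s. s \<in> {a..b} \<Longrightarrow> g s = r * f s"
    and W: "\<And>t. t \<in> {a..c} \<Longrightarrow> W t \<in> borel_measurable M" and ab: "a \<le> b" "b \<le> c"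
  shows "AE \<omega> in M. K \<omega> = r * I \<omega> + J \<omega>"
proof -
  have Wab: "\<And>t. t \<in> {a..b} \<Longrightarrow> W t \<in> borel_measurable M"
    and Wbc: "\<And>t. t \<in> {b..c} \<Longrightarrow> W t \<in> borel_measurable M"
    using W ab by auto
  obtain \<delta> where \<delta>: "\<forall>k. 0 < \<delta> k" "\<forall>N p. fine_partitions a b \<delta> N p \<longrightarrow>
           (AE \<omega> in M. (\<lambda>k. ito_sum f W (N k) (p k) \<omega>) \<longlonglongrightarrow> I \<omega>)"
    using has_stochastic_integral_AE_limit[OF I Wab] by blast
  obtain \<delta>' where \<delta>': "\<forall>k. 0 < \<delta>' k" "\<forall>N p. fine_partitions b c \<delta>' N p \<longrightarrow>
           (AE \<omega> in M. (\<lambda>k. ito_sum g W (N k) (p k) \<omega>) \<longlonglongrightarrow> J \<omega>)"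
    using has_stochastic_integral_AE_limit[OF J Wbc] by blast
  obtain \<delta>'' where \<delta>'': "\<forall>k. 0 < \<delta>'' k" "\<forall>N p. fine_partitions a c \<delta>'' N p \<longrightarrow>
           (AE \<omega> in M. (\<lambda>k. ito_sum g W (N k) (p k) \<omega>) \<longlonglongrightarrow> K \<omega>)"
    using has_stochastic_integral_AE_limit[OF K W] by blast
  define m where "m k = min (\<delta> k) (min (\<delta>' k) (\<delta>'' k))" for k
  have m: "0 < m k" "m k \<le> \<delta> k" "m k \<le> \<delta>' k" "m k \<le> \<delta>'' k" for k
    using \<delta>(1) \<delta>'(1) \<delta>''(1) by (auto simp: m_def)
  obtain N p where p: "fine_partitions a b m N p"
    using ex_fine_partitions[OF ab(1), of m] m(1) by blast
  obtain L q where q: "fine_partitions b c m L q"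
    using ex_fine_partitions[OF ab(2), of m] m(1) by blast
  define z where "z k = (\<lambda>i. if i \<le> N k then p k i else q k (i - N k))" for k
  note pq = fine_partitionsD(1)[OF p] fine_partitionsD(1)[OF q]
  have z: "fine_partitions a c m (\<lambda>k. N k + L k) z"
    unfolding fine_partitions_def z_def
  proof (rule allI, rule conjI)
    fix k
    show "partition_of a c (N k + L k) (\<lambda>i. if i \<le> N k then p k i else q k (i - N k))"
      by (rule partition_of_concat(1)[OF pq])
    show "\<forall>i<N k + L k. (if Suc i \<le> N k then p k (Suc i) else q k (Suc i - N k)) -
       (if i \<le> N k then p k i else q k (i - N k)) < m k"
      using fine_partitionsD(2)[OF p, of _ k] fine_partitionsD(2)[OF q, of _ k]
      by (intro partition_of_concat(2)[OF pq]) auto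
  qed
  have "ito_sum g W (N k) (p k) \<omega> = r * ito_sum f W (N k) (p k) \<omega>" for k \<omega>
    using partition_of_mem[OF pq(1)[of k]] fg
    by (auto simp: ito_sum_def sum_distrib_left intro!: sum.cong)
  then have eq: "ito_sum g W (N k + L k) (z k) \<omega>
      = r * ito_sum f W (N k) (p k) \<omega> + ito_sum g W (L k) (q k) \<omega>" for k \<omega>
    unfolding z_def partition_of_concat(3)[OF pq] by simp
  have "AE \<omega> in M. (\<lambda>k. ito_sum f W (N k) (p k) \<omega>) \<longlonglongrightarrow> I \<omega>"
    using fine_partitions_mono[OF p, of \<delta>] m \<delta>(2) by simp
  moreover have "AE \<omega> in M. (\<lambda>k. ito_sum g W (L k) (q k) \<omega>) \<longlonglongrightarrow> J \<omega>"
    using fine_partitions_mono[OF q, of \<delta>'] m \<delta>'(2) by simp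
  moreover have "AE \<omega> in M. (\<lambda>k. ito_sum g W (N k + L k) (z k) \<omega>) \<longlonglongrightarrow> K \<omega>"
    using fine_partitions_mono[OF z, of \<delta>''] m \<delta>''(2) by simp
  ultimately show ?thesis
  proof eventually_elim
    case (elim \<omega>)
    then have "(\<lambda>k. ito_sum g W (N k + L k) (z k) \<omega>) \<longlonglongrightarrow> r * I \<omega> + J \<omega>"
      unfolding eq by (intro tendsto_intros)
    then show ?case using elim(3) by (rule LIMSEQ_unique[rotated])
  qed
qed

text \<open>Multiplication by a unit vector is an isometry, so the same tolerances work. The
  integrand is prescribed on \<open>{a..b}\<close> only, since a semigroup \<open>S (t - s)\<close>
  is controlled only for s up to t.\<close>

lemma has_stochastic_integral_scaleR_unit:
  fixes f :: "real \<Rightarrow> real" and v :: "'b::{real_normed_vector, second_countable_topology}"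
  assumes I: "has_stochastic_integral M W f a b I" and v: "norm v = 1"
    and g: "\<And>s. s \<in> {a..b} \<Longrightarrow> g s = f s *\<^sub>R v"
  shows "has_stochastic_integral M W g a b (\<lambda>\<omega>. I \<omega> *\<^sub>R v)"
proof -
  have [measurable]: "I \<in> borel_measurable M" using I by (simp add: has_stochastic_integral_def)
  have "dist (ito_sum g W N p \<omega>) (I \<omega> *\<^sub>R v) = dist (ito_sum f W N p \<omega>) (I \<omega>)"
    if "partition_of a b N p" for N p \<omega>
  proof -
    have "ito_sum g W N p \<omega> = ito_sum f W N p \<omega> *\<^sub>R v"
      using partition_of_mem[OF that] g by (auto simp: ito_sum_def scaleR_sum_left intro!: sum.cong)
    then show ?thesis using v by (simp add: dist_norm flip: scaleR_diff_left)
  qed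
  then have eq: "{\<omega>\<in>space M. dist (ito_sum g W N p \<omega>) (I \<omega> *\<^sub>R v) > \<epsilon>}
      = {\<omega>\<in>space M. dist (ito_sum f W N p \<omega>) (I \<omega>) > \<epsilon>}" if "partition_of a b N p" for N p \<epsilon>
    using that by simp
  show ?thesis
    unfolding has_stochastic_integral_def
  proof (intro conjI allI impI)
    fix \<epsilon> :: real assume "0 < \<epsilon>"
    then obtain \<delta> where "0 < \<delta>" "\<forall>N p. partition_of a b N p \<and> (\<forall>i<N. p (Suc i) - p i < \<delta>) \<longrightarrow>
        measure M {\<omega>\<in>space M. dist (ito_sum f W N p \<omega>) (I \<omega>) > \<epsilon>} < \<epsilon>"
      using I unfolding has_stochastic_integral_def by blast
    then show "\<exists>\<delta>>0. \<forall>N p. partition_of a b N p \<and> (\<forall>i<N. p (Suc i) - p i < \<delta>) \<longrightarrow>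
        measure M {\<omega>\<in>space M. dist (ito_sum g W N p \<omega>) (I \<omega> *\<^sub>R v) > \<epsilon>} < \<epsilon>"
      by (intro exI[of _ \<delta>]) (simp add: eq)
  qed measurable
qed

lemma has_stochastic_integral_stochastic_integral:
  "has_stochastic_integral M W f a b I \<Longrightarrow>
     has_stochastic_integral M W f a b (stochastic_integral M W f a b)"
  unfolding stochastic_integral_def by (rule someI[of "has_stochastic_integral M W f a b"])

section \<open>Existence and law of integrals against a stable process\<close>

lemma (in prob_space) ito_sums_cauchy:
  assumes Z: "symmetric_stable_levy_process M \<alpha> Z" and \<alpha>: "0 < \<alpha>" "\<alpha> < 2"
    and ab: "0 \<le> a" "a \<le> b" and f: "continuous_on {a..b} f" and \<eta>: "0 < \<eta>"
  shows "\<exists>\<delta>>0. \<forall>N p K q.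
    partition_of a b N p \<and> (\<forall>i<N. p (Suc i) - p i < \<delta>) \<and>
    partition_of a b K q \<and> (\<forall>i<K. q (Suc i) - q i < \<delta>) \<longrightarrow>
      expectation (\<lambda>\<omega>. square_defect (ito_sum f Z N p \<omega> - ito_sum f Z K q \<omega>)) \<le> \<eta>"
proof -
  \<comment> \<open>Solves for the oscillation whose scale bound, doubled, stays below
    \<open>\<eta>\<close>. The summand 1 keeps the denominator positive when
    \<open>a = b\<close>.\<close>
  define \<theta> where "\<theta> = (\<eta> / (2 * (b - a) + 1)) powr (1 / \<alpha>)"
  have pos: "0 < 2 * (b - a) + 1" using ab by simp
  then have "0 < \<theta>" using \<eta> by (simp add: \<theta>_def)
  have *: "\<theta> powr \<alpha> = \<eta> / (2 * (b - a) + 1)"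
    using \<alpha> \<eta> pos by (simp add: \<theta>_def powr_powr)
  have \<theta>: "2 * (\<theta> powr \<alpha> * (b - a)) \<le> \<eta>"
  proof -
    have "\<theta> powr \<alpha> * (2 * (b - a)) \<le> \<theta> powr \<alpha> * (2 * (b - a) + 1)" by (intro mult_left_mono) auto
    also have "\<dots> = \<eta>" using * pos by simp
    finally show ?thesis by (simp add: algebra_simps)
  qed
  have "uniformly_continuous_on {a..b} f"
    using f by (intro compact_uniformly_continuous) auto
  then obtain \<delta> where \<delta>: "0 < \<delta>"
    "\<And>s t. s \<in> {a..b} \<Longrightarrow> t \<in> {a..b} \<Longrightarrow> \<bar>s - t\<bar> < \<delta> \<Longrightarrow> \<bar>f s - f t\<bar> \<le> \<theta>"
    using \<open>0 < \<theta>\<close> unfolding uniformly_continuous_on_def dist_real_def by (metis less_imp_le)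
  show ?thesis
  proof (intro exI[of _ \<delta>] conjI allI impI \<delta>(1))
    fix N p K q
    assume "partition_of a b N p \<and> (\<forall>i<N. p (Suc i) - p i < \<delta>) \<and>
      partition_of a b K q \<and> (\<forall>i<K. q (Suc i) - q i < \<delta>)"
    then have pq: "partition_of a b N p" "\<forall>i<N. p (Suc i) - p i < \<delta>"
      "partition_of a b K q" "\<forall>i<K. q (Suc i) - q i < \<delta>" by simp_all
    have "\<exists>c. 0 \<le> c \<and> c \<le> \<theta> powr \<alpha> * (b - a) \<and>
        stable_rv \<alpha> c (\<lambda>\<omega>. ito_sum f Z N p \<omega> - ito_sum f Z K q \<omega>)"
      by (rule ito_sum_diff_stable[OF Z \<alpha>(1) ab(1) pq]) (rule \<delta>(2))
    then obtain c where c: "0 \<le> c" "c \<le> \<theta> powr \<alpha> * (b - a)"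
      "stable_rv \<alpha> c (\<lambda>\<omega>. ito_sum f Z N p \<omega> - ito_sum f Z K q \<omega>)"
      by (elim exE conjE)
    show "expectation (\<lambda>\<omega>. square_defect (ito_sum f Z N p \<omega> - ito_sum f Z K q \<omega>)) \<le> \<eta>"
      using expectation_square_defect_stable_le[OF c(3,1) \<alpha>] c(2) \<theta> by linarith
  qed
qed

text \<open>A rapidly Cauchy sequence of sums converges almost surely by Borel-Cantelli. The Cauchy
  estimate then compares its limit with every sufficiently fine sum, as the definition of the
  integral demands.\<close>

lemma (in prob_space) stable_integral_exists:
  fixes f :: "real \<Rightarrow> real"
  assumes Z: "symmetric_stable_levy_process M \<alpha> Z" and \<alpha>: "0 < \<alpha>" "\<alpha> < 2"
    and ab: "0 \<le> a" "a \<le> b" and f: "continuous_on {a..b} f"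
  shows "has_stochastic_integral M Z f a b (stochastic_integral M Z f a b)"
proof -
  define L where "L X = expectation (\<lambda>\<omega>. square_defect (X \<omega>))" for X
  \<comment> \<open>Chosen so that Markov's inequality at level \<open>(1/2)^k\<close> yields
    probability at most \<open>(1/2)^k\<close>.\<close>
  define sd where "sd k = (1/2)^k * square_defect ((1/2)^k)" for k :: nat
  have sd: "0 < sd k" for k by (simp add: sd_def square_defect_pos)
  have Zm: "Z t \<in> borel_measurable M" if "t \<in> {a..b}" for t
    using stable_levyD(1)[OF Z] ab that by simp
  have "\<exists>\<delta>>0. \<forall>N p K q.
    partition_of a b N p \<and> (\<forall>i<N. p (Suc i) - p i < \<delta>) \<and>
    partition_of a b K q \<and> (\<forall>i<K. q (Suc i) - q i < \<delta>) \<longrightarrow>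
      L (\<lambda>\<omega>. ito_sum f Z N p \<omega> - ito_sum f Z K q \<omega>) \<le> \<eta>" if "0 < \<eta>" for \<eta>
    using ito_sums_cauchy[OF Z \<alpha> ab f that] by (simp add: L_def)
  then have "\<forall>\<eta>::real. \<exists>\<delta>::real. 0 < \<eta> \<longrightarrow> 0 < \<delta> \<and> (\<forall>N p K q.
    partition_of a b N p \<and> (\<forall>i<N. p (Suc i) - p i < \<delta>) \<and>
    partition_of a b K q \<and> (\<forall>i<K. q (Suc i) - q i < \<delta>) \<longrightarrow>
      L (\<lambda>\<omega>. ito_sum f Z N p \<omega> - ito_sum f Z K q \<omega>) \<le> \<eta>)" by blast
  then obtain \<delta> where "\<forall>\<eta>. 0 < \<eta> \<longrightarrow> 0 < \<delta> \<eta> \<and> (\<forall>N p K q.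
    partition_of a b N p \<and> (\<forall>i<N. p (Suc i) - p i < \<delta> \<eta>) \<and>
    partition_of a b K q \<and> (\<forall>i<K. q (Suc i) - q i < \<delta> \<eta>) \<longrightarrow>
      L (\<lambda>\<omega>. ito_sum f Z N p \<omega> - ito_sum f Z K q \<omega>) \<le> \<eta>)"
    by atomize_elim (rule choice)
  then have \<delta>: "\<And>\<eta>. 0 < \<eta> \<Longrightarrow> 0 < \<delta> \<eta>"
    "\<And>\<eta> N p K q. 0 < \<eta> \<Longrightarrow> partition_of a b N p \<Longrightarrow> \<forall>i<N. p (Suc i) - p i < \<delta> \<eta> \<Longrightarrow>
      partition_of a b K q \<Longrightarrow> \<forall>i<K. q (Suc i) - q i < \<delta> \<eta> \<Longrightarrow>
      L (\<lambda>\<omega>. ito_sum f Z N p \<omega> - ito_sum f Z K q \<omega>) \<le> \<eta>"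
    by blast+
  \<comment> \<open>The minimum over all \<open>j \<le> k\<close> makes the meshes at
    \<open>k\<close> and at \<open>Suc k\<close> both meet the tolerance for \<open>sd k\<close>.
    The bound \<open>1 / real (Suc k)\<close> lets the mesh tend to 0, so that eventually every
    other tolerance is met as well.\<close>
  define m where "m k = min (1 / real (Suc k)) (Min ((\<lambda>j. \<delta> (sd j)) ` {..k}))" for k
  have m: "0 < m k" for k using \<delta>(1) sd by (simp add: m_def)
  have m_le: "m k \<le> \<delta> (sd j)" if "j \<le> k" for j k
    using that by (auto simp: m_def min_le_iff_disj intro!: Min_le)
  obtain K q where "fine_partitions a b m K q"
    using ex_fine_partitions[OF ab(2), of m] m by blast
  then have q: "\<And>k. partition_of a b (K k) (q k)" "\<And>k. \<forall>i<K k. q k (Suc i) - q k i < m k"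
    by (auto simp: fine_partitions_def)
  define X where "X k = ito_sum f Z (K k) (q k)" for k
  have Xm [measurable]: "X k \<in> borel_measurable M" for k
    unfolding X_def by (rule ito_sum_measurable[OF Zm q(1)])
  have "AE \<omega> in M. \<forall>\<^sub>F k in sequentially. \<omega> \<in> space M - {\<omega>\<in>space M. \<bar>X (Suc k) \<omega> - X k \<omega>\<bar> > (1/2)^k}"
  proof (rule borel_cantelli_AE1)
    have "prob {\<omega>\<in>space M. \<bar>X (Suc k) \<omega> - X k \<omega>\<bar> > (1/2)^k} \<le> (1/2)^k" for k
    proof -
      have fine: "q k' (Suc i) - q k' i < \<delta> (sd k)" if "k \<le> k'" "i < K k'" for k' i
        using q(2) m_le[OF that(1)] that(2) by (meson less_le_trans)
      have "L (\<lambda>\<omega>. X (Suc k) \<omega> - X k \<omega>) \<le> sd k"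
        unfolding X_def by (intro \<delta>(2) sd q(1) allI impI fine) simp_all
      then have "L (\<lambda>\<omega>. X (Suc k) \<omega> - X k \<omega>) / square_defect ((1/2)^k) \<le> (1/2)^k"
        by (simp add: sd_def square_defect_pos divide_le_eq)
      moreover have "prob {\<omega>\<in>space M. \<bar>X (Suc k) \<omega> - X k \<omega>\<bar> > (1/2)^k}
          \<le> L (\<lambda>\<omega>. X (Suc k) \<omega> - X k \<omega>) / square_defect ((1/2)^k)"
        unfolding L_def by (rule prob_gt_le_square_defect) auto
      ultimately show ?thesis by linarith
    qed
    then show "summable (\<lambda>k. prob {\<omega>\<in>space M. \<bar>X (Suc k) \<omega> - X k \<omega>\<bar> > (1/2)^k})"
      by - (rule summable_comparison_test'[of "\<lambda>k. (1/2)^k" 0], auto)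
  qed (auto simp: less_top[symmetric])
  then have conv: "AE \<omega> in M. (\<lambda>k. X k \<omega>) \<longlonglongrightarrow> lim (\<lambda>k. X k \<omega>)"
  proof eventually_elim
    case (elim \<omega>)
    then have "\<forall>\<^sub>F k in sequentially. norm (X (Suc k) \<omega> - X k \<omega>) \<le> (1/2)^k"
      by eventually_elim auto
    then have "summable (\<lambda>k. X (Suc k) \<omega> - X k \<omega>)"
      by (rule summable_comparison_test_ev) auto
    then have "convergent (\<lambda>n. \<Sum>k<n. X (Suc k) \<omega> - X k \<omega>)"
      by (simp add: summable_iff_convergent)
    then have "convergent (\<lambda>n. X n \<omega> - X 0 \<omega>)"
      by (simp add: sum_lessThan_telescope[of "\<lambda>k. X k \<omega>"])
    then have "convergent (\<lambda>n. (X n \<omega> - X 0 \<omega>) + X 0 \<omega>)"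
      by (intro convergent_add convergent_const)
    then show ?case by (simp add: convergent_LIMSEQ_iff)
  qed
  \<comment> \<open>\<open>lim\<close> is total, so the candidate is measurable without removing the
    null set of divergence.\<close>
  define I where "I \<omega> = lim (\<lambda>k. X k \<omega>)" for \<omega>
  have Im [measurable]: "I \<in> borel_measurable M"
    unfolding I_def[abs_def] by (intro borel_measurable_lim_metric Xm)
  have "has_stochastic_integral M Z f a b I"
    unfolding has_stochastic_integral_def
  proof (intro conjI allI impI Im)
    fix \<epsilon> :: real assume \<epsilon>: "0 < \<epsilon>"
    \<comment> \<open>Markov's inequality turns this into probability at most \<epsilon>/2, which
      gives the strict inequality required.\<close>
    define \<eta> where "\<eta> = \<epsilon> * square_defect \<epsilon> / 2"
    have sde: "0 < square_defect \<epsilon>" using \<epsilon> by (simp add: square_defect_pos)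
    then have \<eta>: "0 < \<eta>" using \<epsilon> by (simp add: \<eta>_def)
    show "\<exists>\<delta>>0. \<forall>N p. partition_of a b N p \<and> (\<forall>i<N. p (Suc i) - p i < \<delta>) \<longrightarrow>
        prob {\<omega> \<in> space M. dist (ito_sum f Z N p \<omega>) (I \<omega>) > \<epsilon>} < \<epsilon>"
    proof (intro exI[of _ "\<delta> \<eta>"] conjI allI impI \<delta>(1) \<eta>)
      fix N p assume p: "partition_of a b N p \<and> (\<forall>i<N. p (Suc i) - p i < \<delta> \<eta>)"
      define S where "S = ito_sum f Z N p"
      have Sm [measurable]: "S \<in> borel_measurable M"
        unfolding S_def using p by (intro ito_sum_measurable[OF Zm]) auto
      \<comment> \<open>Since the integrand is bounded and continuous, the Cauchy bound passes to
        the limit by dominated convergence, and no triangle inequality for \<open>L\<close> is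
        needed.\<close>
      have "(\<lambda>k. L (\<lambda>\<omega>. S \<omega> - X k \<omega>)) \<longlonglongrightarrow> L (\<lambda>\<omega>. S \<omega> - I \<omega>)"
        unfolding L_def
      proof (rule integral_dominated_convergence[where w="\<lambda>_. 1"])
        show "AE \<omega> in M. (\<lambda>k. square_defect (S \<omega> - X k \<omega>)) \<longlonglongrightarrow> square_defect (S \<omega> - I \<omega>)"
          using conv
        proof eventually_elim
          case (elim \<omega>)
          then show ?case unfolding I_def
            by (intro isCont_tendsto_compose[OF isCont_square_defect] tendsto_intros)
        qed
      qed (auto simp: square_defect_nonneg square_defect_le_1)
      moreover have "\<forall>\<^sub>F k in sequentially. L (\<lambda>\<omega>. S \<omega> - X k \<omega>) \<le> \<eta>"
      proof -
        have "\<forall>\<^sub>F k in sequentially. 1 / real (Suc k) < \<delta> \<eta>"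
          using LIMSEQ_inverse_real_of_nat \<delta>(1)[OF \<eta>] by (auto simp: order_tendsto_iff inverse_eq_divide)
        then show ?thesis
        proof eventually_elim
          case (elim k)
          then have "m k < \<delta> \<eta>" by (simp add: m_def)
          then show ?case unfolding S_def X_def
            using p q(2)[of k] by (intro \<delta>(2) \<eta> q(1)) (blast, blast, meson less_trans)
        qed
      qed
      ultimately have "L (\<lambda>\<omega>. S \<omega> - I \<omega>) \<le> \<eta>"
        by (intro tendsto_upperbound[where F=sequentially]) auto
      then have "L (\<lambda>\<omega>. S \<omega> - I \<omega>) / square_defect \<epsilon> \<le> \<epsilon> / 2"
        using sde by (simp add: \<eta>_def field_simps)
      moreover have "prob {\<omega> \<in> space M. \<bar>S \<omega> - I \<omega>\<bar> > \<epsilon>} \<le> L (\<lambda>\<omega>. S \<omega> - I \<omega>) / square_defect \<epsilon>"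
        unfolding L_def using \<epsilon> by (intro prob_gt_le_square_defect) auto
      ultimately have "prob {\<omega> \<in> space M. \<bar>S \<omega> - I \<omega>\<bar> > \<epsilon>} \<le> \<epsilon> / 2" by (rule order_trans[rotated])
      then show "prob {\<omega> \<in> space M. dist (ito_sum f Z N p \<omega>) (I \<omega>) > \<epsilon>} < \<epsilon>"
        using \<epsilon> by (simp add: S_def dist_real_def)
    qed
  qed
  then show ?thesis by (rule has_stochastic_integral_stochastic_integral)
qed

text \<open>The scales of the approximating sums are Riemann sums of the \<alpha>-th power of the
  integrand, with antiderivative \<open>G\<close>; almost sure convergence carries the
  characteristic functions to the limit.\<close>

lemma (in prob_space) stable_integral_law:
  assumes Z: "symmetric_stable_levy_process M \<alpha> Z" and \<alpha>: "0 < \<alpha>"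
    and ab: "0 \<le> a" "a \<le> b" and f: "continuous_on {a..b} f"
    and I: "has_stochastic_integral M Z f a b I"
    and G: "\<And>s. a \<le> s \<Longrightarrow> s \<le> b \<Longrightarrow> (G has_real_derivative \<bar>f s\<bar> powr \<alpha>) (at s)"
  shows "stable_rv \<alpha> (G b - G a) I"
proof -
  have Zm: "Z t \<in> borel_measurable M" if "t \<in> {a..b}" for t
    using stable_levyD(1)[OF Z] ab that by simp
  have Im [measurable]: "I \<in> borel_measurable M" using I by (simp add: has_stochastic_integral_def)
  obtain \<delta> where \<delta>: "\<forall>k. 0 < \<delta> k" "\<forall>N p. fine_partitions a b \<delta> N p \<longrightarrow>
           (AE \<omega> in M. (\<lambda>k. ito_sum f Z (N k) (p k) \<omega>) \<longlonglongrightarrow> I \<omega>)"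
    using has_stochastic_integral_AE_limit[OF I Zm] by blast
  \<comment> \<open>The tolerances \<open>\<delta>\<close> need not tend to 0; the second bound
    forces the mesh to do so, for the Riemann sums.\<close>
  define m where "m k = min (\<delta> k) (1 / real (Suc k))" for k
  have m: "0 < m k" for k using \<delta> by (simp add: m_def)
  obtain K q where fine: "fine_partitions a b m K q"
    using ex_fine_partitions[OF ab(2), of m] m by blast
  then have q: "\<And>k. partition_of a b (K k) (q k)" "\<And>k. \<forall>i<K k. q k (Suc i) - q k i < m k"
    by (auto simp: fine_partitions_def)
  define c where "c k = (\<Sum>i<K k. \<bar>f (q k i)\<bar> powr \<alpha> * (q k (Suc i) - q k i))" for k
  have st: "stable_rv \<alpha> (c k) (ito_sum f Z (K k) (q k))" for k
    unfolding c_def by (rule stable_ito_sum[OF Z ab(1) q(1)])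
  have lim: "AE \<omega> in M. (\<lambda>k. ito_sum f Z (K k) (q k) \<omega>) \<longlonglongrightarrow> I \<omega>"
    using fine_partitions_mono[OF fine, of \<delta>] \<delta>(2) by (simp add: m_def)
  have c: "c \<longlonglongrightarrow> G b - G a"
  proof (rule LIMSEQ_I)
    fix r :: real assume r: "0 < r"
    define \<theta> where "\<theta> = r / (b - a + 1)"
    have \<theta>: "0 < \<theta>" "\<theta> * (b - a) < r" using r ab by (auto simp: \<theta>_def field_simps)
    have "uniformly_continuous_on {a..b} (\<lambda>s. \<bar>f s\<bar> powr \<alpha>)"
      using f \<alpha> by (intro compact_uniformly_continuous continuous_intros continuous_on_powr') auto
    then obtain d where d: "0 < d"
      "\<And>s t. s \<in> {a..b} \<Longrightarrow> t \<in> {a..b} \<Longrightarrow> \<bar>s - t\<bar> < d \<Longrightarrow> \<bar>\<bar>f s\<bar> powr \<alpha> - \<bar>f t\<bar> powr \<alpha>\<bar> \<le> \<theta>"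
      using \<theta>(1) unfolding uniformly_continuous_on_def dist_real_def by (metis less_imp_le)
    have "\<forall>\<^sub>F k in sequentially. 1 / real (Suc k) < d"
      using LIMSEQ_inverse_real_of_nat d(1) by (auto simp: order_tendsto_iff inverse_eq_divide)
    then obtain k0 where k0: "\<And>k. k0 \<le> k \<Longrightarrow> 1 / real (Suc k) < d"
      by (auto simp: eventually_sequentially)
    have "norm (c k - (G b - G a)) < r" if "k0 \<le> k" for k
    proof -
      have "m k < d" using k0[OF that] by (simp add: m_def)
      then have "\<forall>i<K k. q k (Suc i) - q k i < d" using q(2)[of k] by (meson less_trans)
      then have "\<bar>c k - (G b - G a)\<bar> \<le> \<theta> * (b - a)"
        unfolding c_def by (rule left_riemann_sum_bound[OF q(1) _ G d(2)])
      then show ?thesis using \<theta>(2) by simp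
    qed
    then show "\<exists>k0. \<forall>k\<ge>k0. norm (c k - (G b - G a)) < r" by blast
  qed
  have "char (distr M borel I) u = complex_of_real (exp (- (G b - G a) * \<bar>u\<bar> powr \<alpha>))" for u
  proof (rule LIMSEQ_unique)
    have [measurable]: "ito_sum f Z (K k) (q k) \<in> borel_measurable M" for k
      using st by (rule stable_rv_measurable)
    have "(\<lambda>k. CLINT \<omega>|M. iexp (u * ito_sum f Z (K k) (q k) \<omega>)) \<longlonglongrightarrow> (CLINT \<omega>|M. iexp (u * I \<omega>))"
    proof (rule integral_dominated_convergence[where w="\<lambda>_. 1"])
      show "AE \<omega> in M. (\<lambda>k. iexp (u * ito_sum f Z (K k) (q k) \<omega>)) \<longlonglongrightarrow> iexp (u * I \<omega>)"
        using lim by eventually_elim (intro tendsto_intros)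
    qed (auto simp del: of_real_mult simp: norm_exp_i_times)
    then show "(\<lambda>k. char (distr M borel (ito_sum f Z (K k) (q k))) u) \<longlonglongrightarrow> char (distr M borel I) u"
      by (simp add: char_def integral_distr)
    have "char (distr M borel (ito_sum f Z (K k) (q k))) u = complex_of_real (exp (- c k * \<bar>u\<bar> powr \<alpha>))" for k
      using st[of k] unfolding stable_rv_def by blast
    then show "(\<lambda>k. char (distr M borel (ito_sum f Z (K k) (q k))) u)
        \<longlonglongrightarrow> complex_of_real (exp (- (G b - G a) * \<bar>u\<bar> powr \<alpha>))"
      by (simp only:) (intro tendsto_intros c)
  qed
  then show ?thesis by (simp add: stable_rv_def)
qed

subsection \<open>Independent integrals and summability of squares\<close>

text \<open>The integral of \<open>(b * exp (- c * u)) powr \<alpha>\<close> over u from 0 to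
  \<open>h\<close>, for positive \<open>b\<close>. It involves only the length of the time interval,
  which makes the noise stationary.\<close>

definition ou_scale :: "real \<Rightarrow> real \<Rightarrow> real \<Rightarrow> real \<Rightarrow> real" where
  "ou_scale \<alpha> b c h = b powr \<alpha> * (1 - exp (- (\<alpha> * c * h))) / (\<alpha> * c)"

lemma (in prob_space) ou_integral:
  assumes Z: "symmetric_stable_levy_process M \<alpha> Z" and \<alpha>: "0 < \<alpha>" "\<alpha> < 2"
    and r: "0 \<le> r" "r \<le> t" and b: "0 < b" and c: "0 < c"
  shows "has_stochastic_integral M Z (\<lambda>s. exp (- c * (t - s)) * b) r t
           (stochastic_integral M Z (\<lambda>s. exp (- c * (t - s)) * b) r t)"
    and "stable_rv \<alpha> (ou_scale \<alpha> b c (t - r)) (stochastic_integral M Z (\<lambda>s. exp (- c * (t - s)) * b) r t)"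
proof -
  have cont: "continuous_on {r..t} (\<lambda>s. exp (- c * (t - s)) * b)"
    by (intro continuous_intros)
  show I: "has_stochastic_integral M Z (\<lambda>s. exp (- c * (t - s)) * b) r t
           (stochastic_integral M Z (\<lambda>s. exp (- c * (t - s)) * b) r t)"
    by (rule stable_integral_exists[OF Z \<alpha> r cont])
  define G where "G s = b powr \<alpha> * exp (- (\<alpha> * c * (t - s))) / (\<alpha> * c)" for s
  have "(G has_real_derivative \<bar>exp (- c * (t - s)) * b\<bar> powr \<alpha>) (at s)" for s
  proof -
    have "\<bar>exp (- c * (t - s)) * b\<bar> powr \<alpha> = b powr \<alpha> * exp (- (\<alpha> * c * (t - s)))"
      using b by (simp add: abs_mult powr_mult) (simp add: powr_def mult_ac)
    then show ?thesis unfolding G_def using \<alpha> c by (auto intro!: derivative_eq_intros)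
  qed
  then have "stable_rv \<alpha> (G t - G r) (stochastic_integral M Z (\<lambda>s. exp (- c * (t - s)) * b) r t)"
    by (intro stable_integral_law[OF Z \<alpha>(1) r cont I])
  also have "G t - G r = ou_scale \<alpha> b c (t - r)"
    by (simp add: G_def ou_scale_def right_diff_distrib diff_divide_distrib)
  finally show "stable_rv \<alpha> (ou_scale \<alpha> b c (t - r)) (stochastic_integral M Z (\<lambda>s. exp (- c * (t - s)) * b) r t)" .
qed

lemma ou_scale_nonneg: "0 < \<alpha> \<Longrightarrow> 0 < c \<Longrightarrow> 0 \<le> h \<Longrightarrow> 0 \<le> ou_scale \<alpha> b c h"
  by (simp add: ou_scale_def)

lemma ou_scale_le: "0 < \<alpha> \<Longrightarrow> 0 < c \<Longrightarrow> ou_scale \<alpha> b c h \<le> (1 / \<alpha>) * (b powr \<alpha> / c)"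
  by (simp add: ou_scale_def divide_simps mult_left_le)

text \<open>Time 1 is enough for necessity: once \<open>c\<close> is at least 1, the exponential is
  at most exp(-\<alpha>).\<close>

lemma ou_scale_ge:
  assumes "0 < \<alpha>" "1 \<le> c"
  shows "(1 - exp (- \<alpha>)) / \<alpha> * (b powr \<alpha> / c) \<le> ou_scale \<alpha> b c 1"
proof -
  have "\<alpha> * 1 \<le> \<alpha> * c" using assms by (intro mult_left_mono) auto
  then have "b powr \<alpha> * (1 - exp (- \<alpha>)) \<le> b powr \<alpha> * (1 - exp (- (\<alpha> * c)))"
    by (intro mult_left_mono) auto
  then have "b powr \<alpha> * (1 - exp (- \<alpha>)) / (\<alpha> * c) \<le> b powr \<alpha> * (1 - exp (- (\<alpha> * c))) / (\<alpha> * c)"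
    using assms by (intro divide_right_mono) auto
  then show ?thesis by (simp add: ou_scale_def mult_ac)
qed

text \<open>Each \<open>J n\<close> is an everywhere defined limit along partitions fixed in
  advance. It is a measurable function of the path of \<open>Z n\<close>, which gives independence,
  and it uses increments from \<open>a\<close> on only, which gives measurability. As
  \<open>J\<close> is chosen before \<open>G\<close>, one version serves the filtration and the
  future increments alike.\<close>

lemma (in prob_space) independent_integral_versions:
  fixes f :: "nat \<Rightarrow> real \<Rightarrow> real"
  assumes indep: "independent_processes M Z"
    and Z: "\<And>n t. t \<in> {a..b} \<Longrightarrow> Z n t \<in> borel_measurable M"
    and ab: "0 \<le> a" "a \<le> b"
    and I: "\<And>n. has_stochastic_integral M (Z n) (f n) a b (I n)"
  shows "\<exists>J. (\<forall>n. AE \<omega> in M. I n \<omega> = J n \<omega>) \<and> indep_vars (\<lambda>_. borel) J UNIV \<and>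
    (\<forall>n G. (\<forall>t\<in>{a..b}. (\<lambda>\<omega>. Z n t \<omega> - Z n a \<omega>) \<in> borel_measurable G) \<longrightarrow> J n \<in> borel_measurable G)"
proof -
  have "\<forall>n. \<exists>Np. (\<forall>k. partition_of a b (fst Np k) (snd Np k)) \<and>
      (AE \<omega> in M. (\<lambda>k. ito_sum (f n) (Z n) (fst Np k) (snd Np k) \<omega>) \<longlonglongrightarrow> I n \<omega>)"
  proof
    fix n
    obtain \<delta> where \<delta>: "\<forall>k. 0 < \<delta> k" "\<forall>N p. fine_partitions a b \<delta> N p \<longrightarrow>
           (AE \<omega> in M. (\<lambda>k. ito_sum (f n) (Z n) (N k) (p k) \<omega>) \<longlonglongrightarrow> I n \<omega>)"
      using has_stochastic_integral_AE_limit[OF I Z] by blast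
    obtain N p where p: "fine_partitions a b \<delta> N p"
      using ex_fine_partitions[OF ab(2), of \<delta>] \<delta>(1) by blast
    show "\<exists>Np. (\<forall>k. partition_of a b (fst Np k) (snd Np k)) \<and>
      (AE \<omega> in M. (\<lambda>k. ito_sum (f n) (Z n) (fst Np k) (snd Np k) \<omega>) \<longlonglongrightarrow> I n \<omega>)"
      using fine_partitionsD(1)[OF p] \<delta>(2) p by (intro exI[of _ "(N, p)"]) simp
  qed
  then obtain Np where Np: "\<forall>n. (\<forall>k. partition_of a b (fst (Np n) k) (snd (Np n) k)) \<and>
      (AE \<omega> in M. (\<lambda>k. ito_sum (f n) (Z n) (fst (Np n) k) (snd (Np n) k) \<omega>) \<longlonglongrightarrow> I n \<omega>)"
    by atomize_elim (rule choice)
  define N p where "N n = fst (Np n)" and "p n = snd (Np n)" for n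
  have p: "partition_of a b (N n k) (p n k)"
    and lim: "AE \<omega> in M. (\<lambda>k. ito_sum (f n) (Z n) (N n k) (p n k) \<omega>) \<longlonglongrightarrow> I n \<omega>" for n k
    using Np by (auto simp: N_def p_def)
  \<comment> \<open>The limit of the sums as a functional on path space, with coordinate evaluation
    as integrator; independence of the paths passes to its values.\<close>
  define \<Psi> where "\<Psi> n \<pi> = lim (\<lambda>k. ito_sum (f n) (\<lambda>t \<pi>. \<pi> t) (N n k) (p n k) \<pi>)"
    for n and \<pi> :: "real \<Rightarrow> real"
  define J where "J n \<omega> = lim (\<lambda>k. ito_sum (f n) (Z n) (N n k) (p n k) \<omega>)" for n \<omega>
  show ?thesis
  proof (intro exI[of _ J] conjI allI impI)
    show "AE \<omega> in M. I n \<omega> = J n \<omega>" for n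
      using lim[of n] by eventually_elim (simp add: J_def limI)
    have "\<Psi> n \<in> borel_measurable (\<Pi>\<^sub>M t\<in>{0..}. borel)" for n
      unfolding \<Psi>_def
    proof (rule borel_measurable_lim_metric)
      show "ito_sum (f n) (\<lambda>t \<pi>. \<pi> t) (N n k) (p n k) \<in> borel_measurable (\<Pi>\<^sub>M t\<in>{0..}. borel)" for k
        by (rule ito_sum_measurable[OF _ p]) (use ab in \<open>auto intro: measurable_component_singleton\<close>)
    qed
    then have "indep_vars (\<lambda>_. borel) (\<lambda>n \<omega>. \<Psi> n (\<lambda>t\<in>{0..}. Z n t \<omega>)) UNIV"
      using indep unfolding independent_processes_def by (rule indep_vars_compose2[rotated])
    moreover have "\<Psi> n (\<lambda>t\<in>{0..}. Z n t \<omega>) = J n \<omega>" for n \<omega>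
    proof -
      have "0 \<le> p n k i" if "i \<le> N n k" for k i
        using partition_of_mem[OF p that] ab by auto
      then have "ito_sum (f n) (\<lambda>t \<pi>. \<pi> t) (N n k) (p n k) (\<lambda>t\<in>{0..}. Z n t \<omega>)
          = ito_sum (f n) (Z n) (N n k) (p n k) \<omega>" for k
        unfolding ito_sum_def by (intro sum.cong) auto
      then show ?thesis by (simp add: \<Psi>_def J_def)
    qed
    ultimately show "indep_vars (\<lambda>_. borel) J UNIV" by simp
    fix n and G :: "'a measure"
    assume G: "\<forall>t\<in>{a..b}. (\<lambda>\<omega>. Z n t \<omega> - Z n a \<omega>) \<in> borel_measurable G"
    \<comment> \<open>The sums contain differences of the integrator only, so subtracting its value
      at \<open>a\<close> changes nothing.\<close>
    have "ito_sum (f n) (Z n) (N n k) (p n k)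
        = ito_sum (f n) (\<lambda>t \<omega>. Z n t \<omega> - Z n a \<omega>) (N n k) (p n k)" for k
      by (simp add: ito_sum_def[abs_def])
    then have "ito_sum (f n) (Z n) (N n k) (p n k) \<in> borel_measurable G" for k
      using ito_sum_measurable[OF bspec[OF G] p] by simp
    then show "J n \<in> borel_measurable G"
      unfolding J_def by (intro borel_measurable_lim_metric)
  qed
qed

text \<open>Countably many almost sure equalities hold simultaneously, so the whole sequence has the
  law of its independent version.\<close>

lemma (in prob_space) distr_PiM_of_indep_version:
  fixes I J :: "nat \<Rightarrow> 'a \<Rightarrow> real"
  assumes J: "indep_vars (\<lambda>_. borel) J UNIV" and IJ: "\<And>n. AE \<omega> in M. I n \<omega> = J n \<omega>"
    and I: "\<And>n. I n \<in> borel_measurable M"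
  shows "distr M (\<Pi>\<^sub>M n\<in>UNIV. borel) (\<lambda>\<omega> n. I n \<omega>) = (\<Pi>\<^sub>M n\<in>UNIV. distr M borel (I n))"
proof -
  have Jm: "J n \<in> borel_measurable M" for n using J by (auto simp: indep_vars_def)
  have "AE \<omega> in M. \<forall>n. I n \<omega> = J n \<omega>" using IJ by (simp add: AE_all_countable)
  then have "AE \<omega> in M. (\<lambda>n. I n \<omega>) = (\<lambda>n. J n \<omega>)" by eventually_elim auto
  then have "distr M (\<Pi>\<^sub>M n\<in>UNIV. borel) (\<lambda>\<omega> n. I n \<omega>) = distr M (\<Pi>\<^sub>M n\<in>UNIV. borel) (\<lambda>\<omega> n. J n \<omega>)"
    by (intro distr_cong_AE) (auto intro!: measurable_PiM_single' I Jm)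
  also have "\<dots> = (\<Pi>\<^sub>M n\<in>UNIV. distr M borel (J n))"
    using indep_vars_iff_distr_eq_PiM[of UNIV J "\<lambda>_. borel"] J Jm by (simp add: restrict_UNIV)
  also have "\<dots> = (\<Pi>\<^sub>M n\<in>UNIV. distr M borel (I n))"
    using IJ by (intro PiM_cong refl distr_cong_AE) (auto intro: I Jm simp: eq_commute)
  finally show ?thesis .
qed

section \<open>Summability of squares and of scales\<close>

lemma summable_square_of_square_defect:
  "summable (\<lambda>n. square_defect (y n)) \<Longrightarrow> summable (\<lambda>n. (y n)\<^sup>2)"
proof -
  assume s: "summable (\<lambda>n. square_defect (y n))"
  then have "(\<lambda>n. square_defect (y n)) \<longlonglongrightarrow> 0" by (rule summable_LIMSEQ_zero)
  \<comment> \<open>Below 1/4 the comparison constant 4 forces the minimum of 1 and the square to be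
    the square itself.\<close>
  then have "\<forall>\<^sub>F n in sequentially. square_defect (y n) < 1/4" by (rule order_tendstoD) simp
  then have "\<forall>\<^sub>F n in sequentially. norm ((y n)\<^sup>2) \<le> 4 * square_defect (y n)"
  proof eventually_elim
    case (elim n)
    then show ?case using min_square_le_square_defect[of "y n"] by (auto simp: min_def split: if_splits)
  qed
  then show ?thesis by (rule summable_comparison_test_ev) (intro summable_mult s)
qed

text \<open>The expected sum of the defects is at most twice the sum of the scales, so the sum of
  the defects is almost surely finite.\<close>

lemma (in prob_space) AE_summable_square_stable:
  assumes Y: "\<And>n. stable_rv \<alpha> (c n) (Y n)" and c: "\<And>n. 0 \<le> c n" "summable c"
    and \<alpha>: "0 < \<alpha>" "\<alpha> < 2"
  shows "AE \<omega> in M. summable (\<lambda>n. (Y n \<omega>)\<^sup>2)"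
proof -
  have [measurable]: "Y n \<in> borel_measurable M" for n using Y by (rule stable_rv_measurable)
  have "(\<integral>\<^sup>+\<omega>. (\<Sum>n. ennreal (square_defect (Y n \<omega>))) \<partial>M)
      = (\<Sum>n. \<integral>\<^sup>+\<omega>. ennreal (square_defect (Y n \<omega>)) \<partial>M)"
    by (rule nn_integral_suminf) measurable
  also have "\<dots> \<le> (\<Sum>n. ennreal (2 * c n))"
  proof (intro suminf_le summableI)
    fix n
    have "(\<integral>\<^sup>+\<omega>. ennreal (square_defect (Y n \<omega>)) \<partial>M) = ennreal (expectation (\<lambda>\<omega>. square_defect (Y n \<omega>)))"
      by (intro nn_integral_eq_integral integrable_square_defect) (auto simp: square_defect_nonneg)
    also have "\<dots> \<le> ennreal (2 * c n)"
      by (intro ennreal_leI expectation_square_defect_stable_le[OF Y c(1) \<alpha>])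
    finally show "(\<integral>\<^sup>+\<omega>. ennreal (square_defect (Y n \<omega>)) \<partial>M) \<le> ennreal (2 * c n)" .
  qed
  also have "\<dots> = ennreal (\<Sum>n. 2 * c n)"
    using c by (intro suminf_ennreal2 summable_mult) auto
  finally have "(\<integral>\<^sup>+\<omega>. (\<Sum>n. ennreal (square_defect (Y n \<omega>))) \<partial>M) \<noteq> \<infinity>"
    by (auto simp: top_unique)
  then have "AE \<omega> in M. (\<Sum>n. ennreal (square_defect (Y n \<omega>))) \<noteq> \<infinity>"
    by (intro nn_integral_PInf_AE) measurable
  then show ?thesis
  proof eventually_elim
    case (elim \<omega>)
    then show ?case
      by (intro summable_square_of_square_defect summable_suminf_not_top) (auto simp: square_defect_nonneg)
  qed
qed

text \<open>If the series converges then \<open>E exp (- \<Sum>n. Y\<^sub>n\<^sup>2 / 2) > 0\<close>; by independence this expectation is an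
  infinite product, whose positivity bounds the sum of the defects \<open>1 - E exp (- Y\<^sub>n\<^sup>2 / 2)\<close>.\<close>

lemma (in prob_space) summable_scale_of_summable_square:
  assumes indep: "indep_vars (\<lambda>_. borel) Y UNIV"
    and Y: "\<And>n. stable_rv \<alpha> (c n) (Y n)" and c: "\<And>n. 0 \<le> c n" and \<alpha>: "0 < \<alpha>"
    and sum: "AE \<omega> in M. summable (\<lambda>n. (Y n \<omega>)\<^sup>2)"
  shows "summable c"
proof -
  have [measurable]: "Y n \<in> borel_measurable M" for n using Y by (rule stable_rv_measurable)
  define d where "d n = expectation (\<lambda>\<omega>. square_defect (Y n \<omega>))" for n
  define P where "P N = expectation (\<lambda>\<omega>. exp (- (\<Sum>n<N. (Y n \<omega>)\<^sup>2 / 2)))" for N :: nat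
  define Q where "Q = expectation (\<lambda>\<omega>. exp (- (\<Sum>n. (Y n \<omega>)\<^sup>2 / 2)))"
  have d0: "0 \<le> d n" for n
    unfolding d_def by (intro Bochner_Integration.integral_nonneg) (simp add: square_defect_nonneg)
  have int: "integrable M (\<lambda>\<omega>. exp (- ((Y n \<omega>)\<^sup>2 / 2)))" for n
    by (intro integrable_const_bound[where B=1]) auto
  have E: "expectation (\<lambda>\<omega>. exp (- ((Y n \<omega>)\<^sup>2 / 2))) = 1 - d n" for n
    unfolding d_def square_defect_def using int[of n] by (simp add: prob_space)
  have P_eq: "P N = (\<Prod>n<N. 1 - d n)" for N
  proof -
    have "indep_vars (\<lambda>_. borel) (\<lambda>n \<omega>. exp (- ((Y n \<omega>)\<^sup>2 / 2))) {..<N}"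
      by (rule indep_vars_compose2[OF indep_vars_subset[OF indep]]) auto
    then have "expectation (\<lambda>\<omega>. \<Prod>n<N. exp (- ((Y n \<omega>)\<^sup>2 / 2))) = (\<Prod>n<N. 1 - d n)"
      using int by (subst indep_vars_lebesgue_integral) (auto simp: E)
    then show ?thesis by (simp add: P_def exp_sum[symmetric] sum_negf)
  qed
  have P_lim: "P \<longlonglongrightarrow> Q"
    unfolding P_def Q_def
  proof (rule integral_dominated_convergence[where w="\<lambda>_. 1"])
    show "AE \<omega> in M. (\<lambda>N. exp (- (\<Sum>n<N. (Y n \<omega>)\<^sup>2 / 2))) \<longlonglongrightarrow> exp (- (\<Sum>n. (Y n \<omega>)\<^sup>2 / 2))"
      using sum
    proof eventually_elim
      case (elim \<omega>)
      then have "summable (\<lambda>n. (Y n \<omega>)\<^sup>2 / 2)" by (rule summable_divide)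
      then show ?case by (intro tendsto_intros summable_LIMSEQ)
    qed
  qed (auto intro!: sum_nonneg)
  \<comment> \<open>A nonnegative function with integral 0 vanishes almost everywhere, but an
    exponential never does.\<close>
  have "Q \<noteq> 0"
  proof
    have "integrable M (\<lambda>\<omega>. exp (- (\<Sum>n. (Y n \<omega>)\<^sup>2 / 2)))"
    proof (rule integrable_const_bound[where B=1])
      show "AE \<omega> in M. norm (exp (- (\<Sum>n. (Y n \<omega>)\<^sup>2 / 2))) \<le> 1"
        using sum by eventually_elim (auto intro!: suminf_nonneg summable_divide)
    qed measurable
    moreover assume "Q = 0"
    ultimately have "AE \<omega> in M. exp (- (\<Sum>n. (Y n \<omega>)\<^sup>2 / 2)) = 0"
      unfolding Q_def by (subst (asm) integral_nonneg_eq_0_iff_AE) auto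
    then have "AE \<omega> in M. False" by eventually_elim simp
    then show False by simp
  qed
  moreover have "0 \<le> Q" unfolding Q_def by (intro Bochner_Integration.integral_nonneg) simp
  ultimately have pos: "0 < Q" by simp
  have d1: "d n \<le> 1" for n
  proof -
    have "0 \<le> expectation (\<lambda>\<omega>. exp (- ((Y n \<omega>)\<^sup>2 / 2)))" by (intro Bochner_Integration.integral_nonneg) simp
    then show ?thesis using E[of n] by simp
  qed
  have P_dec: "decseq P"
  proof (rule decseq_SucI)
    show "P (Suc N) \<le> P N" for N
      unfolding P_eq using d0 d1 by (auto intro!: mult_right_le_one_le prod_nonneg)
  qed
  have bound: "(\<Sum>n<N. d n) \<le> - ln Q" for N
  proof -
    have "Q \<le> P N" using decseq_ge[OF P_dec P_lim] .
    also have "P N \<le> (\<Prod>n<N. exp (- d n))"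
      unfolding P_eq using d1 exp_ge_add_one_self[of "- d n" for n] by (intro prod_mono) auto
    also have "\<dots> = exp (- (\<Sum>n<N. d n))" by (simp add: exp_sum[symmetric] sum_negf)
    finally have "ln Q \<le> - (\<Sum>n<N. d n)" using pos by (metis exp_gt_zero ln_exp ln_le_cancel_iff)
    then show ?thesis by simp
  qed
  have sd: "summable d"
    by (rule summableI_nonneg_bounded[OF d0 bound])
  define \<kappa> where "\<kappa> = measure std_normal_distribution {g. 1 \<le> \<bar>g\<bar>}"
  have \<kappa>: "0 < \<kappa>" unfolding \<kappa>_def by (rule std_normal_tail_pos)
  have ge: "\<kappa> * (1 - exp (- c n)) \<le> d n" for n
    unfolding \<kappa>_def d_def by (rule expectation_square_defect_stable_ge[OF Y c \<alpha>])
  have "d \<longlonglongrightarrow> 0" using sd by (rule summable_LIMSEQ_zero)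
  then have "\<forall>\<^sub>F n in sequentially. d n < \<kappa> / 2" using \<kappa> by (intro order_tendstoD) auto
  then have "\<forall>\<^sub>F n in sequentially. norm (c n) \<le> 2 / \<kappa> * d n"
  proof eventually_elim
    case (elim n)
    then have "\<kappa> * (1 - exp (- c n)) \<le> \<kappa> * (1/2)" using ge[of n] by simp
    then have half: "1/2 \<le> exp (- c n)" using \<kappa> by (subst (asm) mult_le_cancel_left_pos) auto
    \<comment> \<open>Rearranged, c exp(-c) \<le> 1 - exp(-c). As exp(-c) is at least 1/2 here, c is
      at most twice 1 - exp(-c), so the defects dominate the scales linearly.\<close>
    have "(1 + c n) * exp (- c n) \<le> 1"
      using exp_ge_add_one_self[of "c n"] c[of n] by (simp add: exp_minus field_simps)
    moreover have "c n * (1/2) \<le> c n * exp (- c n)" using half c[of n] by (intro mult_left_mono) auto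
    ultimately have "c n \<le> 2 * (1 - exp (- c n))" by (simp add: algebra_simps)
    also have "\<dots> \<le> 2 / \<kappa> * d n" using ge[of n] \<kappa> by (simp add: field_simps)
    finally show ?case using c[of n] by simp
  qed
  then show ?thesis by (rule summable_comparison_test_ev) (intro summable_mult sd)
qed

subsection \<open>Orthonormal series and eigenvectors of a semigroup\<close>

lemma norm_sum_orthonormal_squared:
  fixes e :: "nat \<Rightarrow> 'h::real_inner"
  assumes e: "\<And>m n. e m \<bullet> e n = (if m = n then 1 else 0)" and "finite A"
  shows "(norm (\<Sum>i\<in>A. a i *\<^sub>R e i))\<^sup>2 = (\<Sum>i\<in>A. (a i)\<^sup>2)"
proof -
  have "(norm (\<Sum>i\<in>A. a i *\<^sub>R e i))\<^sup>2 = (\<Sum>i\<in>A. a i * (\<Sum>j\<in>A. a j * (e j \<bullet> e i)))"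
    by (simp add: power2_norm_eq_inner inner_sum_left inner_sum_right)
  also have "\<dots> = (\<Sum>i\<in>A. (a i)\<^sup>2)"
    using \<open>finite A\<close> by (simp add: e power2_eq_square if_distrib[where f="\<lambda>x. _ * x"] sum.delta cong: if_cong)
  finally show ?thesis .
qed

lemma summable_orthonormal_series:
  fixes e :: "nat \<Rightarrow> 'h::{real_inner, banach}"
  assumes e: "\<And>m n. e m \<bullet> e n = (if m = n then 1 else 0)" and a: "summable (\<lambda>n. (a n)\<^sup>2)"
  shows "summable (\<lambda>n. a n *\<^sub>R e n)"
  unfolding summable_Cauchy
proof (intro allI impI)
  fix r :: real assume "0 < r"
  then have "0 < r\<^sup>2" by simp
  then obtain N where N: "\<And>m n. N \<le> m \<Longrightarrow> norm (\<Sum>i=m..<n. (a i)\<^sup>2) < r\<^sup>2"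
    using a unfolding summable_Cauchy by blast
  show "\<exists>N. \<forall>m\<ge>N. \<forall>n. norm (\<Sum>i=m..<n. a i *\<^sub>R e i) < r"
  proof (intro exI[of _ N] allI impI)
    fix m n assume "N \<le> m"
    then have "(norm (\<Sum>i=m..<n. a i *\<^sub>R e i))\<^sup>2 < r\<^sup>2"
      using N[of m n] by (simp add: norm_sum_orthonormal_squared[OF e] sum_nonneg)
    then show "norm (\<Sum>i=m..<n. a i *\<^sub>R e i) < r"
      using \<open>0 < r\<close> by (intro power2_less_imp_less[of _ r]) auto
  qed
qed

text \<open>Bessel's inequality, from the nonnegative square norm of the remainder
  \<open>x - y\<close>.\<close>

lemma summable_square_coefficients:
  fixes e :: "nat \<Rightarrow> 'h::real_inner"
  assumes e: "\<And>m n. e m \<bullet> e n = (if m = n then 1 else 0)"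
  shows "summable (\<lambda>n. (x \<bullet> e n)\<^sup>2)"
proof (rule summableI_nonneg_bounded)
  fix N
  define y where "y = (\<Sum>n<N. (x \<bullet> e n) *\<^sub>R e n)"
  have yy: "y \<bullet> y = (\<Sum>n<N. (x \<bullet> e n)\<^sup>2)"
    using norm_sum_orthonormal_squared[OF e, of "{..<N}" "\<lambda>n. x \<bullet> e n"]
    by (simp add: y_def power2_norm_eq_inner)
  have xy: "x \<bullet> y = (\<Sum>n<N. (x \<bullet> e n)\<^sup>2)"
    by (simp add: y_def inner_sum_right power2_eq_square)
  have "0 \<le> (x - y) \<bullet> (x - y)" by simp
  then show "(\<Sum>n<N. (x \<bullet> e n)\<^sup>2) \<le> x \<bullet> x"
    by (simp add: inner_diff_left inner_diff_right inner_commute[of y x] yy xy)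
qed simp

text \<open>The series has some sum \<open>y\<close> by Bessel; \<open>x - y\<close> is orthogonal
  to the span of the basis, hence to its closure, hence to itself.\<close>

lemma orthonormal_expansion:
  fixes e :: "nat \<Rightarrow> 'h::{real_inner, banach}"
  assumes e: "orthonormal_basis e"
  shows "(\<lambda>n. (x \<bullet> e n) *\<^sub>R e n) sums x"
proof -
  have on: "\<And>m n. e m \<bullet> e n = (if m = n then 1 else 0)" and dense: "closure (span (range e)) = UNIV"
    using e by (auto simp: orthonormal_basis_def)
  define y where "y = (\<Sum>n. (x \<bullet> e n) *\<^sub>R e n)"
  have y: "(\<lambda>n. (x \<bullet> e n) *\<^sub>R e n) sums y"
    unfolding y_def using summable_orthonormal_series[OF on summable_square_coefficients[OF on]]
    by (rule summable_sums)
  have ye: "y \<bullet> e m = x \<bullet> e m" for m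
  proof -
    have "(\<lambda>n. ((x \<bullet> e n) *\<^sub>R e n) \<bullet> e m) sums (y \<bullet> e m)"
      by (rule bounded_linear.sums[OF bounded_linear_inner_left y])
    moreover have "(\<lambda>n. ((x \<bullet> e n) *\<^sub>R e n) \<bullet> e m) sums (x \<bullet> e m)"
      using sums_single[of m "\<lambda>n. x \<bullet> e n"] by (simp add: on if_distrib cong: if_cong)
    ultimately show ?thesis by (rule sums_unique2)
  qed
  have "span (range e) \<subseteq> {v. (x - y) \<bullet> v = 0}"
    by (rule span_minimal) (auto simp: ye inner_diff_left inner_add_right intro!: subspaceI)
  then have "closure (span (range e)) \<subseteq> {v. (x - y) \<bullet> v = 0}"
    by (rule closure_minimal) (intro closed_Collect_eq continuous_intros)
  then have "x - y \<in> {v. (x - y) \<bullet> v = 0}" using dense by blast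
  then have "x = y" by simp
  then show ?thesis using y by simp
qed

text \<open>The generator provides one-sided derivatives only, and values are vectors, so the usual
  mean value theorem does not apply. Instead a linear growth bound with arbitrarily small slope is
  continued to the right.\<close>

lemma constant_if_right_derivative_zero:
  fixes u :: "real \<Rightarrow> 'b::real_normed_vector"
  assumes cont: "continuous_on {0..} u"
    and der: "\<And>t. 0 \<le> t \<Longrightarrow> ((\<lambda>h. (u (t + h) - u t) /\<^sub>R h) \<longlongrightarrow> 0) (at_right 0)"
    and T: "0 \<le> T"
  shows "u T = u 0"
proof -
  have le: "norm (u T - u 0) \<le> \<epsilon> * T" if \<epsilon>: "0 < \<epsilon>" for \<epsilon>
  proof (rule ccontr)
    assume contra: "\<not> norm (u T - u 0) \<le> \<epsilon> * T"
    \<comment> \<open>The times at which the growth bound holds form a compact set. Its maximum must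
      be \<open>T\<close>, since the derivative extends the bound slightly beyond any smaller
      time.\<close>
    define B where "B = {s\<in>{0..T}. norm (u s - u 0) \<le> \<epsilon> * s}"
    have cT: "continuous_on {0..T} u" using cont by (rule continuous_on_subset) auto
    have "closed B" unfolding B_def
      by (rule continuous_closedin_preimage_constant[THEN closedin_closed_trans] |
          intro continuous_on_closed_Collect_le continuous_intros cT closed_real_atLeastAtMost)+
    moreover have "B \<subseteq> {0..T}" by (auto simp: B_def)
    ultimately have "compact B" by (metis compact_Icc compact_Int_closed inf.absorb2)
    moreover have "0 \<in> B" using T by (auto simp: B_def)
    ultimately obtain c where c: "c \<in> B" "\<And>s. s \<in> B \<Longrightarrow> s \<le> c"
      using compact_attains_sup[of B] by blast
    have c0: "0 \<le> c" and "c \<le> T" and uc: "norm (u c - u 0) \<le> \<epsilon> * c" using c(1) by (auto simp: B_def)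
    have "c \<noteq> T" using contra uc by auto
    then have "c < T" using \<open>c \<le> T\<close> by simp
    have "\<forall>\<^sub>F h in at_right 0. dist ((u (c + h) - u c) /\<^sub>R h) 0 < \<epsilon>"
      using der[OF c0] \<epsilon> by (rule tendstoD)
    moreover have "\<forall>\<^sub>F h in at_right 0. h < T - c"
      using \<open>c < T\<close> by (intro eventually_at_right_less order_tendstoD(2)[of _ 0]) (auto intro: tendsto_ident_at)
    moreover have "\<forall>\<^sub>F h in at_right (0::real). 0 < h" by (rule eventually_at_right_less)
    ultimately have "\<forall>\<^sub>F h in at_right 0. dist ((u (c + h) - u c) /\<^sub>R h) 0 < \<epsilon> \<and> h < T - c \<and> 0 < h"
      by eventually_elim simp
    then obtain h where h: "norm ((u (c + h) - u c) /\<^sub>R h) < \<epsilon>" "h < T - c" "0 < h"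
      by (auto dest!: eventually_happens simp: trivial_limit_at_right_real)
    have "norm (u (c + h) - u c) / h < \<epsilon>" using h(1,3) by (simp add: divide_inverse mult.commute)
    then have "norm (u (c + h) - u c) \<le> \<epsilon> * h" using h(3) by (simp add: pos_divide_less_eq)
    then have "norm (u (c + h) - u 0) \<le> \<epsilon> * (c + h)"
      using uc norm_triangle_ineq[of "u (c + h) - u c" "u c - u 0"] by (simp add: distrib_left)
    then have "c + h \<in> B" using h c0 by (auto simp: B_def)
    then show False using c(2)[of "c + h"] h by simp
  qed
  have "norm (u T - u 0) \<le> 0"
  proof (rule field_le_epsilon)
    fix r :: real assume "0 < r"
    then have "norm (u T - u 0) \<le> r / (T + 1) * T" using T by (intro le) simp
    also have "\<dots> \<le> r" using T \<open>0 < r\<close> by (simp add: field_simps)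
    finally show "norm (u T - u 0) \<le> 0 + r" by simp
  qed
  then show ?thesis by simp
qed

text \<open>The function exp(c t) S(t) v has right derivative zero: by the semigroup law its
  difference quotient at s is exp(c s) S(s) applied to the quotient at 0, whose limit is -c v + c
  v.\<close>

lemma semigroup_eigenvector:
  fixes S :: "real \<Rightarrow> 'h::real_normed_vector \<Rightarrow> 'h"
  assumes S: "semigroup_generated_by S D A" and v: "v \<in> D" "A v = - c *\<^sub>R v" and t: "0 \<le> t"
  shows "S t v = exp (- c * t) *\<^sub>R v"
proof -
  have bl: "\<And>t. 0 \<le> t \<Longrightarrow> bounded_linear (S t)" and S0: "S 0 v = v"
    and add: "\<And>s t. 0 \<le> s \<Longrightarrow> 0 \<le> t \<Longrightarrow> S (s + t) v = S s (S t v)"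
    and cont: "continuous_on {0..} (\<lambda>t. S t v)"
    and gen: "((\<lambda>h. (S h v - v) /\<^sub>R h) \<longlongrightarrow> - c *\<^sub>R v) (at_right 0)"
    using S v unfolding semigroup_generated_by_def C0_semigroup_def by auto
  define w where "w h = exp (c * h) *\<^sub>R S h v - v" for h
  have "((\<lambda>h. (exp (c * (0 + h)) - exp (c * 0)) / h) \<longlongrightarrow> c) (at 0)"
  proof -
    have "((\<lambda>h. exp (c * h)) has_real_derivative c) (at 0)"
      by (auto intro!: derivative_eq_intros)
    then show ?thesis by (simp add: DERIV_def)
  qed
  then have e: "((\<lambda>h. (exp (c * h) - 1) / h) \<longlongrightarrow> c) (at_right 0)"
    by (simp add: tendsto_within_subset[where S=UNIV])
  have "((\<lambda>h. exp (c * h) *\<^sub>R ((S h v - v) /\<^sub>R h) + ((exp (c * h) - 1) / h) *\<^sub>R v)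
      \<longlongrightarrow> exp (c * 0) *\<^sub>R (- c *\<^sub>R v) + c *\<^sub>R v) (at_right 0)"
    by (intro tendsto_intros e gen)
  then have "((\<lambda>h. exp (c * h) *\<^sub>R ((S h v - v) /\<^sub>R h) + ((exp (c * h) - 1) / h) *\<^sub>R v) \<longlongrightarrow> 0) (at_right 0)"
    by simp
  moreover have "exp (c * h) *\<^sub>R ((S h v - v) /\<^sub>R h) + ((exp (c * h) - 1) / h) *\<^sub>R v = w h /\<^sub>R h" for h
    by (simp add: w_def algebra_simps divide_inverse)
  ultimately have w: "((\<lambda>h. w h /\<^sub>R h) \<longlongrightarrow> 0) (at_right 0)" by simp
  have "(\<lambda>t. exp (c * t) *\<^sub>R S t v) t = (\<lambda>t. exp (c * t) *\<^sub>R S t v) 0"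
  proof (rule constant_if_right_derivative_zero[OF _ _ t])
    show "continuous_on {0..} (\<lambda>t. exp (c * t) *\<^sub>R S t v)" by (intro continuous_intros cont)
    fix s :: real assume s: "0 \<le> s"
    interpret Ss: bounded_linear "S s" by (rule bl[OF s])
    have "((\<lambda>h. exp (c * s) *\<^sub>R S s (w h /\<^sub>R h)) \<longlongrightarrow> exp (c * s) *\<^sub>R S s 0) (at_right 0)"
      by (intro tendsto_intros Ss.tendsto w)
    then have "((\<lambda>h. exp (c * s) *\<^sub>R S s (w h /\<^sub>R h)) \<longlongrightarrow> 0) (at_right 0)"
      by (simp add: Ss.zero)
    moreover have "\<forall>\<^sub>F h in at_right 0. exp (c * s) *\<^sub>R S s (w h /\<^sub>R h)
        = (exp (c * (s + h)) *\<^sub>R S (s + h) v - exp (c * s) *\<^sub>R S s v) /\<^sub>R h"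
      using eventually_at_right_less[of "0::real"]
    proof eventually_elim
      case (elim h)
      then show ?case using s
        by (simp add: w_def add Ss.scaleR Ss.diff exp_add scaleR_diff_right distrib_left mult_ac)
    qed
    ultimately show "((\<lambda>h. (exp (c * (s + h)) *\<^sub>R S (s + h) v - exp (c * s) *\<^sub>R S s v) /\<^sub>R h) \<longlongrightarrow> 0) (at_right 0)"
      by (rule Lim_transform_eventually)
  qed
  then have "exp (- c * t) *\<^sub>R (exp (c * t) *\<^sub>R S t v) = exp (- c * t) *\<^sub>R v" by (simp add: S0)
  then show ?thesis by (simp add: mult_exp_exp)
qed

subsection \<open>Conditioning on an independent variable\<close>

lemma summable_square_add:
  fixes a b :: "nat \<Rightarrow> real"
  assumes "summable (\<lambda>n. (a n)\<^sup>2)" "summable (\<lambda>n. (b n)\<^sup>2)"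
  shows "summable (\<lambda>n. (a n + b n)\<^sup>2)"
proof (rule summable_comparison_test')
  show "summable (\<lambda>n. 2 * (a n)\<^sup>2 + 2 * (b n)\<^sup>2)"
    using assms by (intro summable_add summable_mult)
  fix n :: nat
  have "0 \<le> (a n - b n)\<^sup>2" by simp
  then have "(a n + b n)\<^sup>2 \<le> 2 * (a n)\<^sup>2 + 2 * (b n)\<^sup>2"
    by (simp add: power2_eq_square algebra_simps)
  then show "norm ((a n + b n)\<^sup>2) \<le> 2 * (a n)\<^sup>2 + 2 * (b n)\<^sup>2" by simp
qed

lemma summable_square_mult_le_1:
  fixes a c :: "nat \<Rightarrow> real"
  assumes "summable (\<lambda>n. (a n)\<^sup>2)" "\<And>n. \<bar>c n\<bar> \<le> 1"
  shows "summable (\<lambda>n. (c n * a n)\<^sup>2)"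
proof (rule summable_comparison_test'[OF assms(1)])
  fix n :: nat
  have "(c n)\<^sup>2 \<le> 1" using assms(2)[of n] by (simp add: abs_square_le_1)
  then show "norm ((c n * a n)\<^sup>2) \<le> (a n)\<^sup>2"
    by (simp add: power_mult_distrib mult_left_le_one_le)
qed

text \<open>Preimages under the two functions differ by a null set that belongs to \<open>G\<close>.
  This is how integrals picked by \<open>SOME\<close> inherit measurability from explicit
  versions.\<close>

lemma borel_measurable_AE_subalgebra:
  fixes g :: "'a \<Rightarrow> 'b::topological_space"
  assumes G: "subalgebra M G" "null_sets M \<subseteq> sets G"
    and g: "g \<in> borel_measurable M" and g': "g' \<in> borel_measurable G" and eq: "AE x in M. g x = g' x"
  shows "g \<in> borel_measurable G"
proof (rule measurableI)
  fix A :: "'b set" assume A: "A \<in> sets borel"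
  have sp: "space G = space M" and sub: "sets G \<subseteq> sets M" using G by (auto simp: subalgebra_def)
  obtain N where N: "N \<in> null_sets M" "{x\<in>space M. g x \<noteq> g' x} \<subseteq> N"
    using eq by (auto simp: eventually_ae_filter)
  have "g -` A \<inter> space M \<in> sets M" using g A by (rule measurable_sets)
  then have "g -` A \<inter> space M \<inter> N \<in> null_sets M" using N(1) by (rule null_set_Int1[rotated])
  moreover have "g' -` A \<inter> space G \<in> sets G" using g' A by (rule measurable_sets)
  moreover have "N \<in> sets G" using N(1) G(2) by auto
  moreover have "g -` A \<inter> space G = (g' -` A \<inter> space G - N) \<union> (g -` A \<inter> space M \<inter> N)"
    using N(2) by (auto simp: sp)
  ultimately show "g -` A \<inter> space G \<in> sets G" using G(2) by auto
qed simp

text \<open>The freezing lemma: given \<open>G\<close>, the first argument is held fixed and the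
  independent variable is averaged out. Letting the first argument be \<open>\<omega>\<close> itself
  covers every \<open>G\<close>-measurable quantity at once.\<close>

lemma (in prob_space) real_cond_exp_independent:
  fixes V :: "'a \<Rightarrow> 'b::topological_space" and k :: "'a \<times> 'b \<Rightarrow> real"
  assumes G: "subalgebra M G" and V[measurable]: "V \<in> borel_measurable M"
    and indep: "\<And>A B. A \<in> sets G \<Longrightarrow> B \<in> sets borel \<Longrightarrow>
      prob (A \<inter> (V -` B \<inter> space M)) = prob A * prob (V -` B \<inter> space M)"
    and k: "k \<in> borel_measurable (G \<Otimes>\<^sub>M borel)" and B: "\<And>z. \<bar>k z\<bar> \<le> B"
  shows "AE \<omega> in M. real_cond_exp M G (\<lambda>\<omega>. k (\<omega>, V \<omega>)) \<omega> = (\<integral>\<omega>'. k (\<omega>, V \<omega>') \<partial>M)"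
proof -
  interpret G: finite_measure_subalgebra M G by unfold_locales (rule G)
  have sp: "space G = space M" and sub: "sets G \<subseteq> sets M" using G by (auto simp: subalgebra_def)
  have id[measurable]: "(\<lambda>\<omega>. \<omega>) \<in> measurable M G"
    by (rule measurable_from_subalg[OF G measurable_ident_sets[OF refl]])
  have [measurable_cong]: "sets (distr M G (\<lambda>\<omega>. \<omega>)) = sets G" "sets (distr M borel V) = sets borel"
    by simp_all
  note k[measurable]
  interpret DG: prob_space "distr M G (\<lambda>\<omega>. \<omega>)" by (rule prob_space_distr) measurable
  interpret V: prob_space "distr M borel V" by (rule prob_space_distr) measurable
  interpret GV: pair_prob_space "distr M G (\<lambda>\<omega>. \<omega>)" "distr M borel V" ..
  \<comment> \<open>Independence as a statement about laws: with \<open>G\<close> on the first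
    factor, the pair of the identity and \<open>V\<close> has a product distribution, so Fubini
    applies.\<close>
  have joint: "distr M G (\<lambda>\<omega>. \<omega>) \<Otimes>\<^sub>M distr M borel V = distr M (G \<Otimes>\<^sub>M borel) (\<lambda>\<omega>. (\<omega>, V \<omega>))"
  proof (rule pair_measure_eqI)
    fix A B assume "A \<in> sets (distr M G (\<lambda>\<omega>. \<omega>))" "B \<in> sets (distr M borel V)"
    then have AB: "A \<in> sets G" "B \<in> sets borel" by simp_all
    then have "A \<subseteq> space M" using sub by (auto dest: sets.sets_into_space)
    then have A: "A \<inter> space M = A"
      "(\<lambda>\<omega>. (\<omega>, V \<omega>)) -` (A \<times> B) \<inter> space M = A \<inter> (V -` B \<inter> space M)" by auto
    show "emeasure (distr M G (\<lambda>\<omega>. \<omega>)) A * emeasure (distr M borel V) B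
        = emeasure (distr M (G \<Otimes>\<^sub>M borel) (\<lambda>\<omega>. (\<omega>, V \<omega>))) (A \<times> B)"
      using AB indep[OF AB]
      by (simp add: emeasure_distr A emeasure_eq_measure ennreal_mult'')
  qed (simp_all add: DG.sigma_finite_measure_axioms V.sigma_finite_measure_axioms cong: sets_pair_measure_cong)
  have R: "(\<integral>\<omega>'. k (\<omega>, V \<omega>') \<partial>M) = (\<integral>v. k (\<omega>, v) \<partial>distr M borel V)" if "\<omega> \<in> space M" for \<omega>
  proof -
    have [measurable]: "(\<lambda>v. k (\<omega>, v)) \<in> borel_measurable borel"
      using that G by (intro measurable_compose[OF measurable_Pair1' k]) (auto simp: subalgebra_def)
    show ?thesis by (simp add: integral_distr)
  qed
  have meas_G: "(\<lambda>\<omega>. \<integral>v. k (\<omega>, v) \<partial>distr M borel V) \<in> borel_measurable G"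
    by measurable
  then have meas: "(\<lambda>\<omega>. \<integral>v. k (\<omega>, v) \<partial>distr M borel V) \<in> borel_measurable M"
    by (rule measurable_from_subalg[OF G])
  have "AE \<omega> in M. real_cond_exp M G (\<lambda>\<omega>. k (\<omega>, V \<omega>)) \<omega> = (\<integral>v. k (\<omega>, v) \<partial>distr M borel V)"
  proof (rule G.real_cond_exp_charact)
    show "integrable M (\<lambda>\<omega>. k (\<omega>, V \<omega>))"
      by (rule integrable_const_bound[where B=B]) (use B in auto)
    have "\<bar>\<integral>v. k (\<omega>, v) \<partial>distr M borel V\<bar> \<le> B" if "\<omega> \<in> space M" for \<omega>
    proof -
      have [measurable]: "(\<lambda>v. k (\<omega>, v)) \<in> borel_measurable borel"
        using that G by (intro measurable_compose[OF measurable_Pair1' k]) (auto simp: subalgebra_def)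
      have "(\<integral>v. \<bar>k (\<omega>, v)\<bar> \<partial>distr M borel V) \<le> B"
        using B by (intro V.integral_le_const V.integrable_const_bound[where B=B]) auto
      then show ?thesis by (rule order_trans[OF integral_abs_bound])
    qed
    then show "integrable M (\<lambda>\<omega>. \<integral>v. k (\<omega>, v) \<partial>distr M borel V)"
      by (intro integrable_const_bound[where B=B] meas) (auto intro!: AE_I2)
    show "(\<lambda>\<omega>. \<integral>v. k (\<omega>, v) \<partial>distr M borel V) \<in> borel_measurable G" by (rule meas_G)
    fix A assume A[measurable]: "A \<in> sets G"
    have "(\<integral>\<omega>\<in>A. k (\<omega>, V \<omega>) \<partial>M)
        = (\<integral>z. indicator A (fst z) * k z \<partial>distr M (G \<Otimes>\<^sub>M borel) (\<lambda>\<omega>. (\<omega>, V \<omega>)))"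
      by (subst integral_distr) (auto simp: set_lebesgue_integral_def)
    also have "\<dots> = (\<integral>\<omega>. (\<integral>v. indicator A \<omega> * k (\<omega>, v) \<partial>distr M borel V) \<partial>distr M G (\<lambda>\<omega>. \<omega>))"
      unfolding joint[symmetric]
    proof -
      have int: "integrable (distr M G (\<lambda>\<omega>. \<omega>) \<Otimes>\<^sub>M distr M borel V) (\<lambda>z. indicator A (fst z) * k z)"
      proof (rule GV.P.integrable_const_bound[where B=B])
        have "norm (indicator A (fst z) * k z) \<le> B" for z
          using B[of z] by (cases "fst z \<in> A") auto
        then show "AE z in distr M G (\<lambda>\<omega>. \<omega>) \<Otimes>\<^sub>M distr M borel V. norm (indicator A (fst z) * k z) \<le> B"
          by simp
      qed measurable
      show "(\<integral>z. indicator A (fst z) * k z \<partial>(distr M G (\<lambda>\<omega>. \<omega>) \<Otimes>\<^sub>M distr M borel V))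
          = (\<integral>\<omega>. (\<integral>v. indicator A \<omega> * k (\<omega>, v) \<partial>distr M borel V) \<partial>distr M G (\<lambda>\<omega>. \<omega>))"
        using GV.integral_fst'[OF int] by simp
    qed
    also have "\<dots> = (\<integral>\<omega>. indicator A \<omega> * (\<integral>v. k (\<omega>, v) \<partial>distr M borel V) \<partial>M)"
      using meas_G by (subst integral_distr) auto
    finally show "(\<integral>\<omega>\<in>A. k (\<omega>, V \<omega>) \<partial>M) = (\<integral>\<omega>\<in>A. (\<integral>v. k (\<omega>, v) \<partial>distr M borel V) \<partial>M)"
      by (simp add: set_lebesgue_integral_def)
  qed
  then show ?thesis using R by (auto elim!: AE_mp)
qed

subsection \<open>The Ornstein--Uhlenbeck process\<close>

text \<open>The semigroup is recorded by its action on the basis;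
  \<open>semigroup_eigenvector\<close> supplies \<open>S_e\<close> from the generator.\<close>

locale stable_ou = prob_space M
  for M :: "'a measure" +
  fixes F :: "real \<Rightarrow> 'a measure"
    and Z :: "nat \<Rightarrow> real \<Rightarrow> 'a \<Rightarrow> real" and \<alpha> :: real
    and \<beta> \<gamma> :: "nat \<Rightarrow> real"
    and e :: "nat \<Rightarrow> 'h::{real_inner, banach, second_countable_topology}"
    and S :: "real \<Rightarrow> 'h \<Rightarrow> 'h"
  assumes basis: "orthonormal_basis e"
    and \<alpha>: "0 < \<alpha>" "\<alpha> < 2"
    and filtration: "\<And>t. 0 \<le> t \<Longrightarrow> subalgebra M (F t)" "\<And>t. 0 \<le> t \<Longrightarrow> null_sets M \<subseteq> sets (F t)"
      "\<And>s t. 0 \<le> s \<Longrightarrow> s \<le> t \<Longrightarrow> sets (F s) \<subseteq> sets (F t)"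
    and stable: "\<And>n. symmetric_stable_levy_process M \<alpha> (Z n)"
    and indep: "independent_processes M Z"
    and adapted: "\<And>n. adapted_process F (Z n)"
    and increments: "increments_independent_of_past M F Z"
    and \<beta>: "\<And>n. 0 < \<beta> n"
    and \<gamma>: "\<And>n. 0 < \<gamma> n" "filterlim \<gamma> at_top sequentially"
    and S_linear: "\<And>t. 0 \<le> t \<Longrightarrow> bounded_linear (S t)"
    and S_e: "\<And>t n. 0 \<le> t \<Longrightarrow> S t (e n) = exp (- \<gamma> n * t) *\<^sub>R e n"
begin

abbreviation "conv t n \<equiv> conv_coord M Z \<beta> \<gamma> t n"
abbreviation "X x t \<equiv> ou_process M Z \<beta> \<gamma> e x t"

text \<open>The noise arriving between \<open>t\<close> and \<open>t + h\<close>, damped to time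
  \<open>t + h\<close>.\<close>

definition conv_after :: "real \<Rightarrow> real \<Rightarrow> nat \<Rightarrow> 'a \<Rightarrow> real" where
  "conv_after t h n = stochastic_integral M (Z n) (\<lambda>s. exp (- \<gamma> n * (t + h - s)) * \<beta> n) t (t + h)"

lemma e_orthonormal: "e m \<bullet> e n = (if m = n then 1 else 0)"
  using basis by (simp add: orthonormal_basis_def)

lemma norm_e: "norm (e n) = 1"
  by (simp add: norm_eq_sqrt_inner e_orthonormal)

lemma Z_measurable: "0 \<le> t \<Longrightarrow> Z n t \<in> borel_measurable M"
  by (rule stable_levyD(1)[OF stable])

lemma conv_integral:
  "0 \<le> t \<Longrightarrow> has_stochastic_integral M (Z n) (\<lambda>s. exp (- \<gamma> n * (t - s)) * \<beta> n) 0 t (conv t n)"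
  unfolding conv_coord_def by (rule ou_integral(1)[OF stable \<alpha> _ _ \<beta> \<gamma>(1)]) auto

lemma conv_stable: "0 \<le> t \<Longrightarrow> stable_rv \<alpha> (ou_scale \<alpha> (\<beta> n) (\<gamma> n) t) (conv t n)"
  unfolding conv_coord_def using ou_integral(2)[OF stable[of n] \<alpha>, of 0 t "\<beta> n" "\<gamma> n"] \<beta> \<gamma> by simp

lemma conv_after_integral:
  "0 \<le> t \<Longrightarrow> 0 \<le> h \<Longrightarrow> has_stochastic_integral M (Z n)
     (\<lambda>s. exp (- \<gamma> n * (t + h - s)) * \<beta> n) t (t + h) (conv_after t h n)"
  unfolding conv_after_def by (rule ou_integral(1)[OF stable \<alpha> _ _ \<beta> \<gamma>(1)]) auto

lemma conv_after_stable:
  "0 \<le> t \<Longrightarrow> 0 \<le> h \<Longrightarrow> stable_rv \<alpha> (ou_scale \<alpha> (\<beta> n) (\<gamma> n) h) (conv_after t h n)"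
  unfolding conv_after_def
  using ou_integral(2)[OF stable[of n] \<alpha>, of t "t + h" "\<beta> n" "\<gamma> n"] \<beta> \<gamma> by simp

lemma conv_split:
  assumes "0 \<le> t" "0 \<le> h"
  shows "AE \<omega> in M. conv (t + h) n \<omega> = exp (- \<gamma> n * h) * conv t n \<omega> + conv_after t h n \<omega>"
proof (rule has_stochastic_integral_combine[OF conv_integral conv_after_integral conv_integral])
  show "exp (- \<gamma> n * (t + h - s)) * \<beta> n = exp (- \<gamma> n * h) * (exp (- \<gamma> n * (t - s)) * \<beta> n)" for s
    by (simp add: mult.assoc[symmetric] mult_exp_exp) (simp add: algebra_simps)
qed (use assms in \<open>auto intro: Z_measurable\<close>)

lemma conv_versions:
  assumes "0 \<le> t"
  shows "\<exists>J. (\<forall>n. AE \<omega> in M. conv t n \<omega> = J n \<omega>) \<and> indep_vars (\<lambda>_. borel) J UNIV \<and>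
    (\<forall>n G. (\<forall>s\<in>{0..t}. (\<lambda>\<omega>. Z n s \<omega> - Z n 0 \<omega>) \<in> borel_measurable G) \<longrightarrow> J n \<in> borel_measurable G)"
  using assms by (intro independent_integral_versions[OF indep _ _ _ conv_integral]) (auto intro: Z_measurable)

lemma conv_after_versions:
  assumes "0 \<le> t" "0 \<le> h"
  shows "\<exists>J. (\<forall>n. AE \<omega> in M. conv_after t h n \<omega> = J n \<omega>) \<and> indep_vars (\<lambda>_. borel) J UNIV \<and>
    (\<forall>n G. (\<forall>s\<in>{t..t + h}. (\<lambda>\<omega>. Z n s \<omega> - Z n t \<omega>) \<in> borel_measurable G) \<longrightarrow> J n \<in> borel_measurable G)"
  using assms by (intro independent_integral_versions[OF indep _ _ _ conv_after_integral]) (auto intro: Z_measurable)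

lemma exp_neg_\<gamma>_le_1: "0 \<le> t \<Longrightarrow> \<bar>exp (- \<gamma> n * t)\<bar> \<le> 1"
  using \<gamma>(1)[of n] by simp

lemma summable_initial: "0 \<le> t \<Longrightarrow> summable (\<lambda>n. (exp (- \<gamma> n * t) * (x \<bullet> e n))\<^sup>2)"
  by (rule summable_square_mult_le_1[OF summable_square_coefficients[OF e_orthonormal] exp_neg_\<gamma>_le_1])

text \<open>Time 1 alone decides. The initial term is square summable and can be subtracted; the
  independent versions of what remains then have summable scales.\<close>

lemma summable_if_takes_values_in_H:
  assumes "takes_values_in_H M (ou_coord M Z \<beta> \<gamma> e x)"
  shows "summable (\<lambda>n. \<beta> n powr \<alpha> / \<gamma> n)"
proof -
  have "AE \<omega> in M. summable (\<lambda>n. (ou_coord M Z \<beta> \<gamma> e x 1 n \<omega>)\<^sup>2)"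
    using assms by (simp add: takes_values_in_H_def)
  then have conv: "AE \<omega> in M. summable (\<lambda>n. (conv 1 n \<omega>)\<^sup>2)"
  proof eventually_elim
    case (elim \<omega>)
    have "summable (\<lambda>n. (- (exp (- \<gamma> n * 1) * (x \<bullet> e n)))\<^sup>2)"
      using summable_initial[of 1 x] by simp
    from summable_square_add[OF elim this] show ?case by (simp add: ou_coord_def)
  qed
  obtain J where J: "\<And>n. AE \<omega> in M. conv 1 n \<omega> = J n \<omega>" "indep_vars (\<lambda>_. borel) J UNIV"
    using conv_versions[of 1] by auto
  have "AE \<omega> in M. \<forall>n. conv 1 n \<omega> = J n \<omega>" using J(1) by (simp add: AE_all_countable)
  then have "AE \<omega> in M. summable (\<lambda>n. (J n \<omega>)\<^sup>2)" using conv by eventually_elim simp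
  moreover have "stable_rv \<alpha> (ou_scale \<alpha> (\<beta> n) (\<gamma> n) 1) (J n)" for n
  proof -
    have "conv 1 n \<in> borel_measurable M" "J n \<in> borel_measurable M"
      using conv_stable[of 1 n] J(2) by (auto simp: indep_vars_def dest: stable_rv_measurable)
    then have "distr M borel (conv 1 n) = distr M borel (J n)" "J n \<in> borel_measurable M"
      using J(1)[of n] by (auto intro: distr_cong_AE)
    then show ?thesis using conv_stable[of 1 n] by (simp add: stable_rv_def)
  qed
  ultimately have sum: "summable (\<lambda>n. ou_scale \<alpha> (\<beta> n) (\<gamma> n) 1)"
    by (intro summable_scale_of_summable_square[OF J(2) _ _ \<alpha>(1)] ou_scale_nonneg \<alpha> \<gamma>) auto
  define \<kappa> where "\<kappa> = (1 - exp (- \<alpha>)) / \<alpha>"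
  have \<kappa>: "0 < \<kappa>" using \<alpha> by (simp add: \<kappa>_def)
  \<comment> \<open>Divergence of \<gamma> enters here: eventually the lower bound on the scale has
    a constant that does not depend on \<open>n\<close>.\<close>
  have "\<forall>\<^sub>F n in sequentially. 1 \<le> \<gamma> n" using \<gamma>(2) by (auto simp: filterlim_at_top)
  then have "\<forall>\<^sub>F n in sequentially. norm (\<beta> n powr \<alpha> / \<gamma> n) \<le> 1 / \<kappa> * ou_scale \<alpha> (\<beta> n) (\<gamma> n) 1"
  proof eventually_elim
    case (elim n)
    then show ?case using ou_scale_ge[OF \<alpha>(1) elim, of "\<beta> n"] \<kappa> \<gamma>(1)[of n]
      by (simp add: \<kappa>_def[symmetric] field_simps)
  qed
  then show ?thesis by (rule summable_comparison_test_ev) (intro summable_mult sum)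
qed

section \<open>Consequences of the summability condition\<close>

context
  assumes summable_\<beta>\<gamma>: "summable (\<lambda>n. \<beta> n powr \<alpha> / \<gamma> n)"
begin

lemma summable_ou_scale: "0 \<le> h \<Longrightarrow> summable (\<lambda>n. ou_scale \<alpha> (\<beta> n) (\<gamma> n) h)"
proof (rule summable_comparison_test')
  show "summable (\<lambda>n. (1 / \<alpha>) * (\<beta> n powr \<alpha> / \<gamma> n))" by (intro summable_mult summable_\<beta>\<gamma>)
  show "norm (ou_scale \<alpha> (\<beta> n) (\<gamma> n) h) \<le> (1 / \<alpha>) * (\<beta> n powr \<alpha> / \<gamma> n)" if "0 \<le> h" for n
    using ou_scale_nonneg[OF \<alpha>(1) \<gamma>(1) that] ou_scale_le[OF \<alpha>(1) \<gamma>(1)] by simp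
qed

lemma AE_summable_conv: "0 \<le> t \<Longrightarrow> AE \<omega> in M. summable (\<lambda>n. (conv t n \<omega>)\<^sup>2)"
  by (intro AE_summable_square_stable[OF conv_stable _ summable_ou_scale \<alpha>] ou_scale_nonneg \<alpha> \<gamma>)

lemma AE_summable_ou_coord:
  assumes "0 \<le> t"
  shows "AE \<omega> in M. summable (\<lambda>n. (ou_coord M Z \<beta> \<gamma> e x t n \<omega>)\<^sup>2)"
  using AE_summable_conv[OF assms]
proof eventually_elim
  case (elim \<omega>)
  then show ?case
    unfolding ou_coord_def by (intro summable_square_add summable_initial assms)
qed

lemma takes_values_in_H_if_summable: "takes_values_in_H M (ou_coord M Z \<beta> \<gamma> e x)"
  unfolding takes_values_in_H_def using AE_summable_ou_coord by blast

lemma AE_ou_process_sums: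
  assumes "0 \<le> t"
  shows "AE \<omega> in M. (\<lambda>n. ou_coord M Z \<beta> \<gamma> e x t n \<omega> *\<^sub>R e n) sums X x t \<omega>"
  using AE_summable_ou_coord[OF assms]
  by eventually_elim
     (auto simp: ou_process_def intro!: summable_sums summable_orthonormal_series[OF e_orthonormal])

lemma S_sums:
  assumes t: "0 \<le> t" and "(\<lambda>n. a n *\<^sub>R e n) sums y"
  shows "(\<lambda>n. (exp (- \<gamma> n * t) * a n) *\<^sub>R e n) sums S t y"
proof -
  interpret St: bounded_linear "S t" by (rule S_linear[OF t])
  have "(\<lambda>n. S t (a n *\<^sub>R e n)) sums S t y" by (rule St.sums[OF assms(2)])
  then show ?thesis by (simp add: St.scaleR S_e[OF t] mult.commute)
qed

text \<open>The vector-valued and the scalar integrals come from separate choices by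
  \<open>SOME\<close>, so they agree only almost surely, by uniqueness. Countability of the index
  set gives one exceptional null set for all \<open>n\<close>.\<close>

lemma AE_cylindrical_sums:
  assumes t: "0 \<le> t"
  shows "AE \<omega> in M. (\<lambda>n. conv t n \<omega> *\<^sub>R e n) sums cylindrical_integral M Z \<beta> e (\<lambda>s. S (t - s)) 0 t \<omega>"
proof -
  have "AE \<omega> in M. stochastic_integral M (Z n) (\<lambda>s. S (t - s) (\<beta> n *\<^sub>R e n)) 0 t \<omega> = conv t n \<omega> *\<^sub>R e n" for n
  proof -
    have "S (t - s) (\<beta> n *\<^sub>R e n) = (exp (- \<gamma> n * (t - s)) * \<beta> n) *\<^sub>R e n" if "s \<in> {0..t}" for s
    proof -
      interpret St: bounded_linear "S (t - s)" by (rule S_linear) (use that in auto)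
      show ?thesis using that by (simp add: St.scaleR S_e mult.commute)
    qed
    then have I: "has_stochastic_integral M (Z n) (\<lambda>s. S (t - s) (\<beta> n *\<^sub>R e n)) 0 t (\<lambda>\<omega>. conv t n \<omega> *\<^sub>R e n)"
      by (rule has_stochastic_integral_scaleR_unit[OF conv_integral[OF t] norm_e])
    show ?thesis
      by (rule has_stochastic_integral_unique[OF has_stochastic_integral_stochastic_integral[OF I] I])
         (use t in \<open>auto intro: Z_measurable\<close>)
  qed
  then have "AE \<omega> in M. \<forall>n. stochastic_integral M (Z n) (\<lambda>s. S (t - s) (\<beta> n *\<^sub>R e n)) 0 t \<omega>
      = conv t n \<omega> *\<^sub>R e n"
    by (simp add: AE_all_countable)
  then show ?thesis
    using AE_summable_conv[OF t]
    by eventually_elim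
       (auto simp: cylindrical_integral_def intro!: summable_sums summable_orthonormal_series[OF e_orthonormal])
qed

lemma AE_mild_solution:
  assumes t: "0 \<le> t"
  shows "AE \<omega> in M. (\<lambda>n. ou_coord M Z \<beta> \<gamma> e x t n \<omega> *\<^sub>R e n) sums X x t \<omega>
     \<and> X x t \<omega> = S t x + cylindrical_integral M Z \<beta> e (\<lambda>s. S (t - s)) 0 t \<omega>
     \<and> (\<lambda>n. conv t n \<omega> *\<^sub>R e n) sums cylindrical_integral M Z \<beta> e (\<lambda>s. S (t - s)) 0 t \<omega>"
  using AE_ou_process_sums[OF t, of x] AE_cylindrical_sums[OF t]
proof eventually_elim
  case (elim \<omega>)
  have "(\<lambda>n. ou_coord M Z \<beta> \<gamma> e x t n \<omega> *\<^sub>R e n) sums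
      (S t x + cylindrical_integral M Z \<beta> e (\<lambda>s. S (t - s)) 0 t \<omega>)"
    using sums_add[OF S_sums[OF t orthonormal_expansion[OF basis]] elim(2)]
    by (simp add: ou_coord_def scaleR_add_left)
  then show ?case using elim sums_unique2 by blast
qed

section \<open>Adaptedness and the Markov property\<close>

lemma conv_adapted:
  assumes t: "0 \<le> t"
  shows "conv t n \<in> borel_measurable (F t)"
proof -
  obtain J where J: "\<And>n. AE \<omega> in M. conv t n \<omega> = J n \<omega>"
    "\<forall>n G. (\<forall>s\<in>{0..t}. (\<lambda>\<omega>. Z n s \<omega> - Z n 0 \<omega>) \<in> borel_measurable G) \<longrightarrow> J n \<in> borel_measurable G"
    using conv_versions[OF t] by blast
  have Zs: "Z n s \<in> borel_measurable (F t)" if "s \<in> {0..t}" for s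
  proof (rule measurable_from_subalg)
    show "Z n s \<in> borel_measurable (F s)" using adapted[of n] that by (auto simp: adapted_process_def)
    show "subalgebra (F t) (F s)"
      using filtration(1)[of s] filtration(1)[of t] filtration(3)[of s t] that t
      by (auto simp: subalgebra_def)
  qed
  have "J n \<in> borel_measurable (F t)"
    using Zs t by (intro J(2)[rule_format] borel_measurable_diff) auto
  moreover have "conv t n \<in> borel_measurable M" by (rule stable_rv_measurable[OF conv_stable[OF t]])
  ultimately show ?thesis
    using borel_measurable_AE_subalgebra[OF filtration(1)[OF t] filtration(2)[OF t]] J(1) by blast
qed

lemma ou_process_adapted: "adapted_process F (X x)"
  unfolding adapted_process_def
proof (intro allI impI)
  fix t :: real assume t: "0 \<le> t"
  have [measurable]: "conv t n \<in> borel_measurable (F t)" for n by (rule conv_adapted[OF t])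
  show "X x t \<in> borel_measurable (F t)"
    unfolding ou_process_def[abs_def] ou_coord_def[abs_def] by measurable
qed

lemma series_measurable:
  "(\<lambda>\<pi>. \<Sum>n. \<pi> n *\<^sub>R e n) \<in> borel_measurable (\<Pi>\<^sub>M n\<in>UNIV. (borel :: real measure))"
  by measurable

text \<open>Both coordinate sequences have the same product law, since the scales depend only on the
  duration \<open>h\<close>; the sum of the series is one measurable function of the
  sequence.\<close>

lemma distr_series_conv_after:
  assumes th: "0 \<le> t" "0 \<le> h"
  shows "distr M borel (\<lambda>\<omega>. \<Sum>n. conv_after t h n \<omega> *\<^sub>R e n) = distr M borel (\<lambda>\<omega>. \<Sum>n. conv h n \<omega> *\<^sub>R e n)"
proof -
  have m: "conv h n \<in> borel_measurable M" "conv_after t h n \<in> borel_measurable M" for n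
    using conv_stable[OF th(2)] conv_after_stable[OF th] by (auto dest: stable_rv_measurable)
  obtain J where J: "\<And>n. AE \<omega> in M. conv h n \<omega> = J n \<omega>" "indep_vars (\<lambda>_. borel) J UNIV"
    using conv_versions[OF th(2)] by blast
  obtain J' where J': "\<And>n. AE \<omega> in M. conv_after t h n \<omega> = J' n \<omega>" "indep_vars (\<lambda>_. borel) J' UNIV"
    using conv_after_versions[OF th] by blast
  have "distr M (\<Pi>\<^sub>M n\<in>UNIV. borel) (\<lambda>\<omega> n. conv_after t h n \<omega>)
      = distr M (\<Pi>\<^sub>M n\<in>UNIV. borel) (\<lambda>\<omega> n. conv h n \<omega>)"
    unfolding distr_PiM_of_indep_version[OF J(2,1) m(1)] distr_PiM_of_indep_version[OF J'(2,1) m(2)]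
    by (intro PiM_cong refl stable_rv_distr_unique[OF conv_after_stable[OF th] conv_stable[OF th(2)]])
  then have "distr (distr M (\<Pi>\<^sub>M n\<in>UNIV. borel) (\<lambda>\<omega> n. conv_after t h n \<omega>)) borel (\<lambda>\<pi>. \<Sum>n. \<pi> n *\<^sub>R e n)
      = distr (distr M (\<Pi>\<^sub>M n\<in>UNIV. borel) (\<lambda>\<omega> n. conv h n \<omega>)) borel (\<lambda>\<pi>. \<Sum>n. \<pi> n *\<^sub>R e n)"
    by simp
  then show ?thesis
    using m series_measurable by (simp add: distr_distr comp_def measurable_PiM_single')
qed

text \<open>\<open>V\<close> is built from the explicit versions because
  \<open>increments_after\<close> is not completed by null sets, so equality almost everywhere would
  not give measurability. One \<open>V\<close> serves all starting points \<open>x\<close>.\<close>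

lemma flow_decomposition:
  assumes th: "0 \<le> t" "0 \<le> h"
  obtains V where "V \<in> borel_measurable M" "V \<in> borel_measurable (increments_after M Z t)"
    "distr M borel V = distr M borel (\<lambda>\<omega>. \<Sum>n. conv h n \<omega> *\<^sub>R e n)"
    "\<And>x. AE \<omega> in M. X x (t + h) \<omega> = S h (X x t \<omega>) + V \<omega>"
proof -
  obtain J where J: "\<And>n. AE \<omega> in M. conv_after t h n \<omega> = J n \<omega>" "indep_vars (\<lambda>_. borel) J UNIV"
    "\<forall>n G. (\<forall>s\<in>{t..t + h}. (\<lambda>\<omega>. Z n s \<omega> - Z n t \<omega>) \<in> borel_measurable G) \<longrightarrow> J n \<in> borel_measurable G"
    using conv_after_versions[OF th] by blast
  have Jm[measurable]: "J n \<in> borel_measurable M" for n using J(2) by (auto simp: indep_vars_def)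
  have am[measurable]: "conv_after t h n \<in> borel_measurable M" for n
    by (rule stable_rv_measurable[OF conv_after_stable[OF th]])
  have Ji[measurable]: "J n \<in> borel_measurable (increments_after M Z t)" for n
  proof (rule J(3)[rule_format])
    fix s assume s: "s \<in> {t..t + h}"
    define \<Theta> where "\<Theta> = (\<lambda>\<omega>. \<lambda>(n, u)\<in>UNIV \<times> {t..}. Z n u \<omega> - Z n t \<omega>)"
    have "\<Theta> \<in> measurable (increments_after M Z t) (\<Pi>\<^sub>M _\<in>UNIV \<times> {t..}. borel)"
      unfolding increments_after_def \<Theta>_def
      by (rule measurable_vimage_algebra1) (auto simp: space_PiM)
    then have "(\<lambda>\<omega>. \<Theta> \<omega> (n, s)) \<in> borel_measurable (increments_after M Z t)"
      by (rule measurable_compose[OF _ measurable_component_singleton]) (use s in auto)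
    then show "(\<lambda>\<omega>. Z n s \<omega> - Z n t \<omega>) \<in> borel_measurable (increments_after M Z t)"
      using s by (simp add: \<Theta>_def)
  qed
  have AE_J: "AE \<omega> in M. \<forall>n. conv_after t h n \<omega> = J n \<omega>" using J(1) by (simp add: AE_all_countable)
  have AE_s: "AE \<omega> in M. \<forall>n. conv (t + h) n \<omega> = exp (- \<gamma> n * h) * conv t n \<omega> + conv_after t h n \<omega>"
    using conv_split[OF th] by (simp add: AE_all_countable)
  have AE_sum: "AE \<omega> in M. summable (\<lambda>n. (conv_after t h n \<omega>)\<^sup>2)"
    by (intro AE_summable_square_stable[OF conv_after_stable[OF th] _ summable_ou_scale \<alpha>] ou_scale_nonneg \<alpha> \<gamma> th)
  show ?thesis
  proof (rule that[of "\<lambda>\<omega>. \<Sum>n. J n \<omega> *\<^sub>R e n"])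
    show "(\<lambda>\<omega>. \<Sum>n. J n \<omega> *\<^sub>R e n) \<in> borel_measurable M" by measurable
    show "(\<lambda>\<omega>. \<Sum>n. J n \<omega> *\<^sub>R e n) \<in> borel_measurable (increments_after M Z t)" by measurable
    have "distr M borel (\<lambda>\<omega>. \<Sum>n. J n \<omega> *\<^sub>R e n) = distr M borel (\<lambda>\<omega>. \<Sum>n. conv_after t h n \<omega> *\<^sub>R e n)"
    proof (rule distr_cong_AE[OF refl refl])
      show "AE \<omega> in M. (\<Sum>n. J n \<omega> *\<^sub>R e n) = (\<Sum>n. conv_after t h n \<omega> *\<^sub>R e n)"
        using AE_J by eventually_elim simp
    qed measurable
    then show "distr M borel (\<lambda>\<omega>. \<Sum>n. J n \<omega> *\<^sub>R e n) = distr M borel (\<lambda>\<omega>. \<Sum>n. conv h n \<omega> *\<^sub>R e n)"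
      using distr_series_conv_after[OF th] by simp
    fix x
    have "AE \<omega> in M. (\<lambda>n. ou_coord M Z \<beta> \<gamma> e x (t + h) n \<omega> *\<^sub>R e n) sums X x (t + h) \<omega>"
      using th by (intro AE_ou_process_sums) simp
    then show "AE \<omega> in M. X x (t + h) \<omega> = S h (X x t \<omega>) + (\<Sum>n. J n \<omega> *\<^sub>R e n)"
      using AE_ou_process_sums[OF th(1), of x] AE_J AE_s AE_sum
    proof eventually_elim
      case (elim \<omega>)
      have "(\<lambda>n. J n \<omega> *\<^sub>R e n) sums (\<Sum>n. J n \<omega> *\<^sub>R e n)"
        using elim(3,5) by (intro summable_sums summable_orthonormal_series[OF e_orthonormal]) simp
      from sums_add[OF S_sums[OF th(2) elim(2)] this]
      have "(\<lambda>n. (exp (- \<gamma> n * h) * ou_coord M Z \<beta> \<gamma> e x t n \<omega> + J n \<omega>) *\<^sub>R e n)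
          sums (S h (X x t \<omega>) + (\<Sum>n. J n \<omega> *\<^sub>R e n))"
        by (simp add: scaleR_add_left)
      moreover have "exp (- \<gamma> n * h) * ou_coord M Z \<beta> \<gamma> e x t n \<omega> + J n \<omega> = ou_coord M Z \<beta> \<gamma> e x (t + h) n \<omega>" for n
        using elim(3,4)
        by (simp add: ou_coord_def distrib_left mult.assoc[symmetric] mult_exp_exp)
      ultimately show ?case using elim(1) by (simp add: sums_unique2)
    qed
  qed
qed

text \<open>The state at time \<open>t\<close> is measurable for \<open>F t\<close>, while
  \<open>V\<close> is independent of \<open>F t\<close>: freezing the state leaves an average over
  \<open>V\<close>, which has the law of the noise accumulated in time \<open>h\<close> from
  0.\<close>

lemma ou_process_markovian: "markovian M F (ou_process M Z \<beta> \<gamma> e)"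
  unfolding markovian_def
proof (intro allI impI)
  fix x :: 'h and t h :: real and f :: "'h \<Rightarrow> real"
  assume t: "0 \<le> t" and h: "0 \<le> h" and f: "f \<in> borel_measurable borel \<and> bounded (range f)"
  have fm[measurable]: "f \<in> borel_measurable borel" using f by simp
  obtain B where B: "\<And>y. \<bar>f y\<bar> \<le> B" using f by (auto simp: bounded_iff)
  obtain V where V[measurable]: "V \<in> borel_measurable M"
    and Vi: "V \<in> borel_measurable (increments_after M Z t)"
    and Vd: "distr M borel V = distr M borel (\<lambda>\<omega>. \<Sum>n. conv h n \<omega> *\<^sub>R e n)"
    and XV: "\<And>x. AE \<omega> in M. X x (t + h) \<omega> = S h (X x t \<omega>) + V \<omega>"
    using flow_decomposition[OF t h] by blast
  interpret Ft: finite_measure_subalgebra M "F t" by unfold_locales (rule filtration(1)[OF t])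
  have Sm[measurable]: "S h \<in> borel_measurable borel"
    by (intro borel_measurable_continuous_onI linear_continuous_on S_linear h)
  have XF[measurable]: "X x s \<in> borel_measurable (F s)" if "0 \<le> s" for x s
    using ou_process_adapted[of x] that by (auto simp: adapted_process_def)
  have XM: "X x s \<in> borel_measurable M" if "0 \<le> s" for x s
    using measurable_from_subalg[OF filtration(1)[OF that] XF[OF that]] .
  have XMt[measurable]: "X x t \<in> borel_measurable M" "X x (t + h) \<in> borel_measurable M" for x
    using t h by (auto intro: XM)
  \<comment> \<open>Valid for every \<open>y\<close>, not just almost every one, so the random state
    \<open>X x t \<omega>\<close> may be inserted pathwise at the end.\<close>
  have R: "(\<integral>\<omega>'. f (X y h \<omega>') \<partial>M) = (\<integral>\<omega>'. f (S h y + V \<omega>') \<partial>M)" for y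
  proof -
    have [measurable]: "conv h n \<in> borel_measurable M" for n
      by (rule stable_rv_measurable[OF conv_stable[OF h]])
    have [measurable]: "X y h \<in> borel_measurable M" using h by (rule XM)
    have "(\<integral>\<omega>'. f (X y h \<omega>') \<partial>M) = (\<integral>\<omega>'. f (S h y + (\<Sum>n. conv h n \<omega>' *\<^sub>R e n)) \<partial>M)"
    proof (rule integral_cong_AE)
      show "AE \<omega>' in M. f (X y h \<omega>') = f (S h y + (\<Sum>n. conv h n \<omega>' *\<^sub>R e n))"
        using AE_mild_solution[OF h, of y] by eventually_elim (metis sums_unique)
    qed measurable
    also have "\<dots> = (\<integral>v. f (S h y + v) \<partial>distr M borel (\<lambda>\<omega>. \<Sum>n. conv h n \<omega> *\<^sub>R e n))"
      by (subst integral_distr) auto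
    also have "\<dots> = (\<integral>\<omega>'. f (S h y + V \<omega>') \<partial>M)"
      unfolding Vd[symmetric] by (subst integral_distr) auto
    finally show ?thesis .
  qed
  \<comment> \<open>The first component carries the past and the second the new noise, as the
    freezing lemma requires.\<close>
  define k where "k z = f (S h (X x t (fst z)) + snd z)" for z
  have "AE \<omega> in M. real_cond_exp M (F t) (\<lambda>\<omega>. f (X x (t + h) \<omega>)) \<omega>
      = real_cond_exp M (F t) (\<lambda>\<omega>. k (\<omega>, V \<omega>)) \<omega>"
  proof (rule Ft.real_cond_exp_cong)
    show "AE \<omega> in M. f (X x (t + h) \<omega>) = k (\<omega>, V \<omega>)"
      using XV[of x] by eventually_elim (simp add: k_def)
    show "(\<lambda>\<omega>. k (\<omega>, V \<omega>)) \<in> borel_measurable M" unfolding k_def fst_conv snd_conv by measurable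
  qed measurable
  moreover have "AE \<omega> in M. real_cond_exp M (F t) (\<lambda>\<omega>. k (\<omega>, V \<omega>)) \<omega> = (\<integral>\<omega>'. k (\<omega>, V \<omega>') \<partial>M)"
  proof (rule real_cond_exp_independent[OF filtration(1)[OF t] V])
    have [measurable]: "X x t \<in> borel_measurable (F t)" by (rule XF[OF t])
    show "k \<in> borel_measurable (F t \<Otimes>\<^sub>M borel)" unfolding k_def by measurable
    show "\<bar>k z\<bar> \<le> B" for z by (simp add: k_def B)
    fix A and C :: "'h set" assume AC: "A \<in> sets (F t)" "C \<in> sets borel"
    have "V -` C \<inter> space M \<in> sets (increments_after M Z t)"
      using measurable_sets[OF Vi AC(2)] by (simp add: increments_after_def)
    then show "prob (A \<inter> (V -` C \<inter> space M)) = prob A * prob (V -` C \<inter> space M)"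
      using increments AC(1) t unfolding increments_independent_of_past_def indep_sets2_eq by blast
  qed
  ultimately show "AE \<omega> in M. real_cond_exp M (F t) (\<lambda>\<omega>'. f (X x (t + h) \<omega>')) \<omega>
      = (\<integral>\<omega>'. f (X (X x t \<omega>) h \<omega>') \<partial>M)"
    by eventually_elim (simp add: k_def R)
qed

end

end

theorem proposition4p3:
  fixes M :: "'a measure" and F :: "real \<Rightarrow> 'a measure"
    and Z :: "nat \<Rightarrow> real \<Rightarrow> 'a \<Rightarrow> real" and \<alpha> :: real
    and \<beta> \<gamma> :: "nat \<Rightarrow> real"
    and e :: "nat \<Rightarrow> 'h::{real_inner, banach, second_countable_topology}"
    and D :: "'h set" and A :: "'h \<Rightarrow> 'h" and S :: "real \<Rightarrow> 'h \<Rightarrow> 'h"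
  assumes basis: "orthonormal_basis e"
    and \<alpha>: "0 < \<alpha>" "\<alpha> < 2"
    and stoch_basis: "usual_stochastic_basis M F"
    and stable: "\<And>n. symmetric_stable_levy_process M \<alpha> (Z n)"
    and indep: "independent_processes M Z"
    and adapted: "\<And>n. adapted_process F (Z n)"
    and increments: "increments_independent_of_past M F Z"
    and \<beta>: "\<And>n. 0 < \<beta> n"
    and A: "self_adjoint_operator D A"
    and eigen: "\<And>n. e n \<in> D" "\<And>n. A (e n) = - \<gamma> n *\<^sub>R e n"
    and \<gamma>: "\<And>n. 0 < \<gamma> n" "filterlim \<gamma> at_top sequentially"
    and S: "semigroup_generated_by S D A"
  shows "(\<forall>x. takes_values_in_H M (ou_coord M Z \<beta> \<gamma> e x) \<longleftrightarrow> summable (\<lambda>n. \<beta> n powr \<alpha> / \<gamma> n))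
    \<and> (summable (\<lambda>n. \<beta> n powr \<alpha> / \<gamma> n) \<longrightarrow>
        (let X = ou_process M Z \<beta> \<gamma> e;
             Z\<^sub>A = (\<lambda>t. cylindrical_integral M Z \<beta> e (\<lambda>s. S (t - s)) 0 t)
         in (\<forall>x. \<forall>t\<ge>0. AE \<omega> in M.
               (\<lambda>n. ou_coord M Z \<beta> \<gamma> e x t n \<omega> *\<^sub>R e n) sums X x t \<omega>
             \<and> X x t \<omega> = S t x + Z\<^sub>A t \<omega>
             \<and> (\<lambda>n. conv_coord M Z \<beta> \<gamma> t n \<omega> *\<^sub>R e n) sums Z\<^sub>A t \<omega>)
          \<and> (\<forall>x. adapted_process F (X x))
          \<and> markovian M F X))"
proof -
  have M: "prob_space M" and F: "\<And>t. 0 \<le> t \<Longrightarrow> subalgebra M (F t)"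
    "\<And>s t. 0 \<le> s \<Longrightarrow> s \<le> t \<Longrightarrow> sets (F s) \<subseteq> sets (F t)" "null_sets M \<subseteq> sets (F 0)"
    using stoch_basis unfolding usual_stochastic_basis_def by - (elim conjE, blast)+
  interpret stable_ou M F Z \<alpha> \<beta> \<gamma> e S
  proof (intro stable_ou.intro[OF M] stable_ou_axioms.intro)
    show "null_sets M \<subseteq> sets (F t)" if "0 \<le> t" for t using F(3) F(2)[OF order_refl that] by (rule order_trans)
    show "bounded_linear (S t)" if "0 \<le> t" for t
      using S that by (simp add: semigroup_generated_by_def C0_semigroup_def)
    show "S t (e n) = exp (- \<gamma> n * t) *\<^sub>R e n" if "0 \<le> t" for t n
      by (rule semigroup_eigenvector[OF S eigen(1,2) that])
  qed (use basis \<alpha> F(1,2) stable indep adapted increments \<beta> \<gamma> in blast)+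
  show ?thesis
    unfolding Let_def
    by (intro conjI allI impI iffI)
       (rule summable_if_takes_values_in_H takes_values_in_H_if_summable AE_mild_solution
          ou_process_adapted ou_process_markovian; assumption)+
qed

end
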